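(* There is no sentence $\psi$ of the language $\mathit{MS}_0$ such that, for every (finite) matroid $M$, $M$ is representable over at least one field if and only if $M$ satisfies $\psi$.
   Context: All matroids are finite. $\mathit{MS}_0$ is the following monadic second-order language for matroids. It has variables $X_1,X_2,X_3,\ldots$, atomic formulas $X_i\subseteq X_j$, $\mathrm{Sing}(X_i)$, $\mathrm{Ind}(X_i)$, the connectives $\neg,\land$ and the quantifiers $\exists,\forall$. Formulas $\psi$, with their variable sets $\mathrm{Var}(\psi)$ and free-variable sets $\mathrm{Fr}(\psi)$, are built recursively: an atomic formula has $\mathrm{Fr}=\mathrm{Var}=$ the set of variables occurring in it; $\neg\psi$ has the same $\mathrm{Var}$ and $\mathrm{Fr}$ as $\psi$; $\psi_1\land\psi_2$ is a formula provided $\mathrm{Fr}(\psi_i)\cap(\mathrm{Var}(\psi_j)-\mathrm{Fr}(\psi_j))=\emptyset$ for $\{i,j\}=\{1,2\}$, with $\mathrm{Var}$ and $\mathrm{Fr}$ the respective unions; if $X_i\in\mathrm{Fr}(\psi)$ then $\exists X_i\,\psi$ and $\forall X_i\,\psi$ are formulas with variable set $\mathrm{Var}(\psi)$ and free-variable set $\mathrm{Fr}(\psi)-\{X_i\}$. A sentence is a formula with no free variables. A matroid $M$ satisfies a sentence if the sentence is true when variables range over subsets of the ground set $E(M)$, $X_i\subseteq X_j$ means set containment, $\mathrm{Sing}(X_i)$ means $|X_i|=1$, and $\mathrm{Ind}(X_i)$ means $X_i$ is independent in $M$. *)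

theory Defs
  imports "HOL-Algebra.Generated_Fields" "HOL-Algebra.Weak_Morphisms" "HOL-Library.Countable_Set"
begin

section \<open>Finite matroids\<close>

locale matroid =
  fixes E :: "'e set" and indep :: "'e set \<Rightarrow> bool"
  assumes finite_ground: "finite E"
    and indep_subset_ground: "indep X \<Longrightarrow> X \<subseteq> E"
    and indep_empty: "indep {}"
    and indep_subset: "indep X \<Longrightarrow> Y \<subseteq> X \<Longrightarrow> indep Y"
    and augment: "indep X \<Longrightarrow> indep Y \<Longrightarrow> card Y < card X \<Longrightarrow> \<exists>x\<in>X - Y. indep (insert x Y)"


section \<open>Representability\<close>

text \<open>The columns of the matrix \<open>A\<close> (with rows \<open>i < r\<close>) are indexed by matroid elements. The
  columns labelled by \<open>X\<close> are taken as a family, so that equal columns with different labels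
  are dependent.\<close>

definition lin_indep_columns ::
    "('k, 'm) ring_scheme \<Rightarrow> nat \<Rightarrow> (nat \<Rightarrow> 'e \<Rightarrow> 'k) \<Rightarrow> 'e set \<Rightarrow> bool" where
  "lin_indep_columns F r A X \<longleftrightarrow>
     (\<forall>c \<in> X \<rightarrow> carrier F.
        (\<forall>i<r. (\<Oplus>\<^bsub>F\<^esub>e\<in>X. c e \<otimes>\<^bsub>F\<^esub> A i e) = \<zero>\<^bsub>F\<^esub>) \<longrightarrow> (\<forall>e\<in>X. c e = \<zero>\<^bsub>F\<^esub>))"

definition representable_over ::
    "('k, 'm) ring_scheme \<Rightarrow> 'e set \<Rightarrow> ('e set \<Rightarrow> bool) \<Rightarrow> bool" where
  "representable_over F E indep \<longleftrightarrow>
     (\<exists>r A. (\<forall>i<r. \<forall>e\<in>E. A i e \<in> carrier F) \<and>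
            (\<forall>X\<subseteq>E. indep X \<longleftrightarrow> lin_indep_columns F r A X))"

text \<open>HOL cannot quantify existentially over all types, so the field is taken to have a subset of
  the naturals as its carrier. This loses nothing: \<open>representable_if_representable_over\<close> below
  shows that a matroid representable over a field with carrier in an arbitrary type is
  representable in this sense.\<close>

definition representable :: "'e set \<Rightarrow> ('e set \<Rightarrow> bool) \<Rightarrow> bool" where
  "representable E indep \<longleftrightarrow> (\<exists>F :: nat ring. field F \<and> representable_over F E indep)"

lemma countable_generate_field:
  assumes "countable S"
  shows "countable (generate_field F S)"
proof -
  define step where "step T = insert \<one>\<^bsub>F\<^esub> (S \<union> T \<union> (\<lambda>x. \<ominus>\<^bsub>F\<^esub> x) ` T \<union> (\<lambda>x. inv\<^bsub>F\<^esub> x) ` T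
      \<union> (\<lambda>(x, y). x \<oplus>\<^bsub>F\<^esub> y) ` (T \<times> T) \<union> (\<lambda>(x, y). x \<otimes>\<^bsub>F\<^esub> y) ` (T \<times> T))" for T
  define L where "L n = (step ^^ n) {}" for n
  have L_Suc: "L (Suc n) = step (L n)" for n
    by (simp add: L_def)
  have cnt: "countable (L n)" for n
  proof (induction n)
    case 0
    then show ?case by (simp add: L_def)
  next
    case (Suc n)
    then show ?case using assms by (simp add: L_Suc step_def)
  qed
  have "L n \<subseteq> L (Suc n)" for n
    by (auto simp: L_Suc step_def)
  then have mono: "L m \<subseteq> L n" if "m \<le> n" for m n
    using that by (rule lift_Suc_mono_le)
  have "x \<in> (\<Union>n. L n)" if "x \<in> generate_field F S" for x
    using that
  proof (induction rule: generate_field.induct)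
    case one
    have "\<one>\<^bsub>F\<^esub> \<in> L (Suc 0)" by (simp add: L_Suc step_def)
    then show ?case by blast
  next
    case (incl h)
    then have "h \<in> L (Suc 0)" by (simp add: L_Suc step_def)
    then show ?case by blast
  next
    case (a_inv h)
    then obtain n where "h \<in> L n" by blast
    then have "\<ominus>\<^bsub>F\<^esub> h \<in> L (Suc n)" by (simp add: L_Suc step_def)
    then show ?case by blast
  next
    case (m_inv h)
    then obtain n where "h \<in> L n" by blast
    then have "inv\<^bsub>F\<^esub> h \<in> L (Suc n)" by (simp add: L_Suc step_def)
    then show ?case by blast
  next
    case (eng_add x y)
    then obtain m n where "x \<in> L m" "y \<in> L n" by blast
    then have "x \<in> L (max m n)" "y \<in> L (max m n)"
      using mono[of m "max m n"] mono[of n "max m n"] by auto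
    then have "x \<oplus>\<^bsub>F\<^esub> y \<in> L (Suc (max m n))" by (force simp: L_Suc step_def)
    then show ?case by blast
  next
    case (eng_mult x y)
    then obtain m n where "x \<in> L m" "y \<in> L n" by blast
    then have "x \<in> L (max m n)" "y \<in> L (max m n)"
      using mono[of m "max m n"] mono[of n "max m n"] by auto
    then have "x \<otimes>\<^bsub>F\<^esub> y \<in> L (Suc (max m n))" by (force simp: L_Suc step_def)
    then show ?case by blast
  qed
  then have "generate_field F S \<subseteq> (\<Union>n. L n)" by blast
  then show ?thesis using cnt by (meson countable_UN countable_subset countableI_type)
qed

text \<open>The subfield generated by the entries of the matrix, together with the coefficients of one
  dependency for each dependent set of columns, is countable and represents the same matroid.\<close>

lemma representable_if_representable_over:
  fixes F :: "('k, 'm) ring_scheme"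
  assumes fin: "finite E" and F: "field F" and rep: "representable_over F E indep"
  shows "representable E indep"
proof -
  interpret F: field F by (rule F)
  obtain r A where A: "\<And>i e. i < r \<Longrightarrow> e \<in> E \<Longrightarrow> A i e \<in> carrier F"
    and iff: "\<And>X. X \<subseteq> E \<Longrightarrow> indep X \<longleftrightarrow> lin_indep_columns F r A X"
    using rep unfolding representable_over_def by blast
  define dep where "dep X d \<longleftrightarrow> d \<in> X \<rightarrow> carrier F
      \<and> (\<forall>i<r. (\<Oplus>\<^bsub>F\<^esub>e\<in>X. d e \<otimes>\<^bsub>F\<^esub> A i e) = \<zero>\<^bsub>F\<^esub>) \<and> (\<exists>e\<in>X. d e \<noteq> \<zero>\<^bsub>F\<^esub>)" for X d
  define D where "D X = (SOME d. dep X d)" for X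
  have D: "dep X (D X)" if "\<not> lin_indep_columns F r A X" for X
  proof -
    have "\<exists>d. dep X d" using that unfolding lin_indep_columns_def dep_def by blast
    then show ?thesis unfolding D_def by (rule someI_ex)
  qed
  define S where "S = ((\<lambda>(i, e). A i e) ` ({..<r} \<times> E)
      \<union> (\<lambda>(X, e). D X e) ` (Pow E \<times> E)) \<inter> carrier F"
  have "finite S" unfolding S_def using fin by blast
  define K where "K = generate_field F S"
  have S: "S \<subseteq> carrier F" by (simp add: S_def)
  have SK: "S \<subseteq> K" unfolding K_def by (auto intro: generate_field.incl)
  have KF: "K \<subseteq> carrier F" unfolding K_def by (rule F.generate_field_incl[OF S])
  have "countable K"
    unfolding K_def using \<open>finite S\<close> by (simp add: countable_generate_field countable_finite)
  then obtain g :: "'k \<Rightarrow> nat" where g: "inj_on g K" by (auto simp: countable_def)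
  interpret K: field "F\<lparr>carrier := K\<rparr>"
    unfolding K_def by (rule F.generate_field_is_field[OF S])
  define G where "G = image_ring g (F\<lparr>carrier := K\<rparr>)"
  have fieldG: "field G"
    unfolding G_def by (rule K.inj_imp_image_ring_is_field) (simp add: g)
  interpret G: field G by (rule fieldG)
  define h where "h = inv_into K g"
  have G_simps: "carrier G = g ` K" "\<zero>\<^bsub>G\<^esub> = g \<zero>\<^bsub>F\<^esub>" "\<one>\<^bsub>G\<^esub> = g \<one>\<^bsub>F\<^esub>"
    "x \<otimes>\<^bsub>G\<^esub> y = g (h x \<otimes>\<^bsub>F\<^esub> h y)" "x \<oplus>\<^bsub>G\<^esub> y = g (h x \<oplus>\<^bsub>F\<^esub> h y)" for x y
    by (simp_all add: G_def h_def image_ring_def image_group_def monoid.defs)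
  have hg: "h (g x) = x" if "x \<in> K" for x
    using that g by (simp add: h_def)
  have K_closed: "\<zero>\<^bsub>F\<^esub> \<in> K" "\<one>\<^bsub>F\<^esub> \<in> K"
    "x \<in> K \<Longrightarrow> y \<in> K \<Longrightarrow> x \<otimes>\<^bsub>F\<^esub> y \<in> K" "x \<in> K \<Longrightarrow> y \<in> K \<Longrightarrow> x \<oplus>\<^bsub>F\<^esub> y \<in> K" for x y
    using K.zero_closed K.one_closed K.m_closed[of x y] K.a_closed[of x y] by simp_all
  have hom: "ring_hom_cring G F h"
  proof (rule ring_hom_cringI)
    show "h \<in> ring_hom G F"
      by (rule ring_hom_memI) (auto simp: G_simps hg K_closed intro: subsetD[OF KF])
  qed (rule G.is_cring F.is_cring)+
  interpret h: ring_hom_cring G F h by (rule hom)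
  have h_zero: "h x = \<zero>\<^bsub>F\<^esub> \<longleftrightarrow> x = \<zero>\<^bsub>G\<^esub>" if "x \<in> carrier G" for x
    using that by (auto simp: G_simps hg K_closed)
  have AK: "A i e \<in> K" if "i < r" "e \<in> E" for i e
    using that A[of i e] SK unfolding S_def by force
  have sum: "h (\<Oplus>\<^bsub>G\<^esub>e\<in>X. c e \<otimes>\<^bsub>G\<^esub> g (A i e)) = (\<Oplus>\<^bsub>F\<^esub>e\<in>X. h (c e) \<otimes>\<^bsub>F\<^esub> A i e)"
    if "X \<subseteq> E" "c \<in> X \<rightarrow> carrier G" "i < r" for X c i
  proof -
    have gA: "g (A i e) \<in> carrier G" if "e \<in> X" for e
      using AK[of i e] that \<open>X \<subseteq> E\<close> \<open>i < r\<close> by (auto simp: G_simps)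
    have "h (\<Oplus>\<^bsub>G\<^esub>e\<in>X. c e \<otimes>\<^bsub>G\<^esub> g (A i e))
        = (\<Oplus>\<^bsub>F\<^esub>e\<in>X. (h \<circ> (\<lambda>e. c e \<otimes>\<^bsub>G\<^esub> g (A i e))) e)"
      using that(2) gA by (subst h.hom_finsum) (auto simp: comp_def)
    also have "\<dots> = (\<Oplus>\<^bsub>F\<^esub>e\<in>X. h (c e) \<otimes>\<^bsub>F\<^esub> A i e)"
    proof (rule F.finsum_cong')
      show "(\<lambda>e. h (c e) \<otimes>\<^bsub>F\<^esub> A i e) \<in> X \<rightarrow> carrier F"
        using that A by (auto intro!: F.m_closed h.hom_closed)
      show "(h \<circ> (\<lambda>e. c e \<otimes>\<^bsub>G\<^esub> g (A i e))) e = h (c e) \<otimes>\<^bsub>F\<^esub> A i e" if "e \<in> X" for e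
        using that \<open>X \<subseteq> E\<close> \<open>i < r\<close> \<open>c \<in> X \<rightarrow> carrier G\<close> gA[of e] AK[of i e]
        by (auto simp: Pi_iff hg subset_eq)
    qed simp
    finally show ?thesis .
  qed
  have sum_closed: "(\<Oplus>\<^bsub>G\<^esub>e\<in>X. c e \<otimes>\<^bsub>G\<^esub> g (A i e)) \<in> carrier G"
    if "X \<subseteq> E" "c \<in> X \<rightarrow> carrier G" "i < r" for X c i
  proof (rule G.finsum_closed, rule)
    fix e assume "e \<in> X"
    then have "g (A i e) \<in> carrier G" "c e \<in> carrier G"
      using AK[of i e] that by (auto simp: G_simps)
    then show "c e \<otimes>\<^bsub>G\<^esub> g (A i e) \<in> carrier G" by simp
  qed
  have eq: "lin_indep_columns G r (\<lambda>i e. g (A i e)) X \<longleftrightarrow> lin_indep_columns F r A X"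
    if X: "X \<subseteq> E" for X
  proof
    assume L: "lin_indep_columns F r A X"
    show "lin_indep_columns G r (\<lambda>i e. g (A i e)) X"
      unfolding lin_indep_columns_def
    proof (intro ballI impI)
      fix c e assume c: "c \<in> X \<rightarrow> carrier G"
        and z: "\<forall>i<r. (\<Oplus>\<^bsub>G\<^esub>e\<in>X. c e \<otimes>\<^bsub>G\<^esub> g (A i e)) = \<zero>\<^bsub>G\<^esub>" and e: "e \<in> X"
      have "\<forall>i<r. (\<Oplus>\<^bsub>F\<^esub>e\<in>X. h (c e) \<otimes>\<^bsub>F\<^esub> A i e) = \<zero>\<^bsub>F\<^esub>"
        using sum[OF X c] z by (metis h.hom_zero)
      moreover have "(\<lambda>e. h (c e)) \<in> X \<rightarrow> carrier F" using c by auto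
      ultimately have "h (c e) = \<zero>\<^bsub>F\<^esub>"
        using L e unfolding lin_indep_columns_def by (auto dest!: bspec[where x = "\<lambda>e. h (c e)"])
      then show "c e = \<zero>\<^bsub>G\<^esub>" using h_zero c e by blast
    qed
  next
    assume L: "lin_indep_columns G r (\<lambda>i e. g (A i e)) X"
    show "lin_indep_columns F r A X"
    proof (rule ccontr)
      assume "\<not> lin_indep_columns F r A X"
      then have d: "dep X (D X)" by (rule D)
      have DK: "D X e \<in> K" if "e \<in> X" for e
      proof -
        have "D X e \<in> carrier F" using d that by (auto simp: dep_def)
        moreover have "D X e \<in> (\<lambda>(X, e). D X e) ` (Pow E \<times> E)" using that X by force
        ultimately show ?thesis using SK unfolding S_def by blast
      qed
      define c where "c e = g (D X e)" for e
      have c: "c \<in> X \<rightarrow> carrier G" using DK by (auto simp: c_def G_simps)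
      have "(\<Oplus>\<^bsub>G\<^esub>e\<in>X. c e \<otimes>\<^bsub>G\<^esub> g (A i e)) = \<zero>\<^bsub>G\<^esub>" if i: "i < r" for i
      proof -
        have "h (\<Oplus>\<^bsub>G\<^esub>e\<in>X. c e \<otimes>\<^bsub>G\<^esub> g (A i e)) = (\<Oplus>\<^bsub>F\<^esub>e\<in>X. h (c e) \<otimes>\<^bsub>F\<^esub> A i e)"
          by (rule sum[OF X c i])
        also have "\<dots> = (\<Oplus>\<^bsub>F\<^esub>e\<in>X. D X e \<otimes>\<^bsub>F\<^esub> A i e)"
          using X A[OF i] DK KF by (intro F.finsum_cong') (auto simp: c_def hg subset_eq)
        also have "\<dots> = \<zero>\<^bsub>F\<^esub>" using d i by (auto simp: dep_def)
        finally show ?thesis using h_zero[OF sum_closed[OF X c i]] by simp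
      qed
      then have "\<forall>e\<in>X. c e = \<zero>\<^bsub>G\<^esub>"
        using L c unfolding lin_indep_columns_def by blast
      then have "\<forall>e\<in>X. D X e = \<zero>\<^bsub>F\<^esub>"
        using DK hg K_closed(1) by (metis G_simps(2) c_def)
      then show False using d by (auto simp: dep_def)
    qed
  qed
  have "representable_over G E indep"
    unfolding representable_over_def
  proof (intro exI conjI allI impI ballI)
    show "g (A i e) \<in> carrier G" if "i < r" "e \<in> E" for i e
      using AK[OF that] by (simp add: G_simps)
    show "indep X \<longleftrightarrow> lin_indep_columns G r (\<lambda>i e. g (A i e)) X" if "X \<subseteq> E" for X
      using iff[OF that] eq[OF that] by simp
  qed
  then show ?thesis using fieldG unfolding representable_def by blast
qed


section \<open>The language \<open>MS\<^sub>0\<close>\<close>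

text \<open>Variables are indexed by the naturals from 0.\<close>

datatype fm =
    Subset nat nat
  | Sing nat
  | Ind nat
  | Neg fm
  | Conj fm fm
  | Exists nat fm
  | Forall nat fm

primrec Var :: "fm \<Rightarrow> nat set" where
  "Var (Subset i j) = {i, j}"
| "Var (Sing i) = {i}"
| "Var (Ind i) = {i}"
| "Var (Neg \<psi>) = Var \<psi>"
| "Var (Conj \<psi>\<^sub>1 \<psi>\<^sub>2) = Var \<psi>\<^sub>1 \<union> Var \<psi>\<^sub>2"
| "Var (Exists i \<psi>) = Var \<psi>"
| "Var (Forall i \<psi>) = Var \<psi>"

primrec Fr :: "fm \<Rightarrow> nat set" where
  "Fr (Subset i j) = {i, j}"
| "Fr (Sing i) = {i}"
| "Fr (Ind i) = {i}"
| "Fr (Neg \<psi>) = Fr \<psi>"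
| "Fr (Conj \<psi>\<^sub>1 \<psi>\<^sub>2) = Fr \<psi>\<^sub>1 \<union> Fr \<psi>\<^sub>2"
| "Fr (Exists i \<psi>) = Fr \<psi> - {i}"
| "Fr (Forall i \<psi>) = Fr \<psi> - {i}"

text \<open>The datatype contains raw expressions; the formulas of \<open>MS\<^sub>0\<close> are those satisfying the side
  conditions on conjunction and quantification.\<close>

primrec formula :: "fm \<Rightarrow> bool" where
  "formula (Subset i j) \<longleftrightarrow> True"
| "formula (Sing i) \<longleftrightarrow> True"
| "formula (Ind i) \<longleftrightarrow> True"
| "formula (Neg \<psi>) \<longleftrightarrow> formula \<psi>"
| "formula (Conj \<psi>\<^sub>1 \<psi>\<^sub>2) \<longleftrightarrow> formula \<psi>\<^sub>1 \<and> formula \<psi>\<^sub>2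
     \<and> Fr \<psi>\<^sub>1 \<inter> (Var \<psi>\<^sub>2 - Fr \<psi>\<^sub>2) = {} \<and> Fr \<psi>\<^sub>2 \<inter> (Var \<psi>\<^sub>1 - Fr \<psi>\<^sub>1) = {}"
| "formula (Exists i \<psi>) \<longleftrightarrow> formula \<psi> \<and> i \<in> Fr \<psi>"
| "formula (Forall i \<psi>) \<longleftrightarrow> formula \<psi> \<and> i \<in> Fr \<psi>"

definition sentence :: "fm \<Rightarrow> bool" where
  "sentence \<psi> \<longleftrightarrow> formula \<psi> \<and> Fr \<psi> = {}"

primrec holds :: "'e set \<Rightarrow> ('e set \<Rightarrow> bool) \<Rightarrow> fm \<Rightarrow> (nat \<Rightarrow> 'e set) \<Rightarrow> bool" where
  "holds E indep (Subset i j) \<theta> \<longleftrightarrow> \<theta> i \<subseteq> \<theta> j"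
| "holds E indep (Sing i) \<theta> \<longleftrightarrow> card (\<theta> i) = 1"
| "holds E indep (Ind i) \<theta> \<longleftrightarrow> indep (\<theta> i)"
| "holds E indep (Neg \<psi>) \<theta> \<longleftrightarrow> \<not> holds E indep \<psi> \<theta>"
| "holds E indep (Conj \<psi>\<^sub>1 \<psi>\<^sub>2) \<theta> \<longleftrightarrow> holds E indep \<psi>\<^sub>1 \<theta> \<and> holds E indep \<psi>\<^sub>2 \<theta>"
| "holds E indep (Exists i \<psi>) \<theta> \<longleftrightarrow> (\<exists>X\<subseteq>E. holds E indep \<psi> (\<theta>(i := X)))"
| "holds E indep (Forall i \<psi>) \<theta> \<longleftrightarrow> (\<forall>X\<subseteq>E. holds E indep \<psi> (\<theta>(i := X)))"

lemma holds_cong: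
  "(\<And>i. i \<in> Fr \<psi> \<Longrightarrow> \<theta> i = \<theta>' i) \<Longrightarrow> holds E indep \<psi> \<theta> \<longleftrightarrow> holds E indep \<psi> \<theta>'"
proof (induction \<psi> arbitrary: \<theta> \<theta>')
  case (Conj \<psi>\<^sub>1 \<psi>\<^sub>2)
  have "holds E indep \<psi>\<^sub>1 \<theta> \<longleftrightarrow> holds E indep \<psi>\<^sub>1 \<theta>'" by (rule Conj.IH(1)) (simp add: Conj.prems)
  moreover have "holds E indep \<psi>\<^sub>2 \<theta> \<longleftrightarrow> holds E indep \<psi>\<^sub>2 \<theta>'"
    by (rule Conj.IH(2)) (simp add: Conj.prems)
  ultimately show ?case by simp
next
  case (Exists i \<psi>)
  have "holds E indep \<psi> (\<theta>(i := X)) \<longleftrightarrow> holds E indep \<psi> (\<theta>'(i := X))" for X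
    by (rule Exists.IH) (simp add: Exists.prems)
  then show ?case by simp
next
  case (Forall i \<psi>)
  have "holds E indep \<psi> (\<theta>(i := X)) \<longleftrightarrow> holds E indep \<psi> (\<theta>'(i := X))" for X
    by (rule Forall.IH) (simp add: Forall.prems)
  then show ?case by simp
next
  case (Neg \<psi>)
  have "holds E indep \<psi> \<theta> \<longleftrightarrow> holds E indep \<psi> \<theta>'" by (rule Neg.IH) (simp add: Neg.prems)
  then show ?case by simp
qed simp_all

text \<open>The initial assignment is irrelevant for sentences, by \<open>satisfies_iff_holds\<close>.\<close>

definition satisfies :: "'e set \<Rightarrow> ('e set \<Rightarrow> bool) \<Rightarrow> fm \<Rightarrow> bool" where
  "satisfies E indep \<psi> \<longleftrightarrow> holds E indep \<psi> (\<lambda>_. {})"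

lemma satisfies_iff_holds:
  "sentence \<psi> \<Longrightarrow> satisfies E indep \<psi> \<longleftrightarrow> holds E indep \<psi> \<theta>"
  unfolding satisfies_def by (rule holds_cong) (simp add: sentence_def)

end

theory Submission
  imports Defs "HOL-Number_Theory.Residues" "HOL-Library.Nat_Bijection"
begin

text \<open>For a prime \<open>p\<close>, Lazarson's matroid, the column matroid over \<open>\<int>/p\<close> of the matrix
  \<open>[I | J - I | 1]\<close> with \<open>p + 1\<close> rows, is representable only over fields of characteristic \<open>p\<close>.
  By the Feferman--Vaught argument for direct sums, a sentence sees only finitely many types of left
  summands, so for some primes \<open>p \<noteq> q\<close> it cannot tell the sum of the matroids of \<open>p\<close> and \<open>q\<close> from
  the sum of two copies of the matroid of \<open>q\<close>. The latter is representable, whereas a representation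
  of the former would need a field of characteristic both \<open>p\<close> and \<open>q\<close>.\<close>

section \<open>Direct sums and definability\<close>

text \<open>Both summands are representable separately; only the clash of their characteristics
  obstructs the sum, and a formula cannot compare the two sides. The reason is that every subset of
  the ground set splits into a left and a right part, and inclusion, size one and independence are
  each settled from little data about each part. Quantifiers are the obstacle: the data about the
  left side must survive the choice of further sets, so types describe a structure together with an
  assignment, and a quantifier replaces a type by the set of types reachable by changing one
  variable. Infinitely many primes then meet finitely many types. The \<open>p + 1\<close> rows are
  forced by the last dependence wanted: each row of \<open>J - I\<close> sums to \<open>p\<close>,
  so its columns add up to zero modulo \<open>p\<close>. The other dependences used are integer
  identities, and the independences come from unit vectors or from minors equal to 1 or -1.\<close>

definition direct_sum ::
    "'e set \<Rightarrow> ('e set \<Rightarrow> bool) \<Rightarrow> 'e set \<Rightarrow> ('e set \<Rightarrow> bool) \<Rightarrow> 'e set \<Rightarrow> bool" where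
  "direct_sum E\<^sub>1 I\<^sub>1 E\<^sub>2 I\<^sub>2 X \<longleftrightarrow> X \<subseteq> E\<^sub>1 \<union> E\<^sub>2 \<and> I\<^sub>1 (X \<inter> E\<^sub>1) \<and> I\<^sub>2 (X \<inter> E\<^sub>2)"

text \<open>Cardinalities add over the two sides, so the smaller set is smaller on at least one
  side; augmenting there leaves the other side untouched.\<close>

lemma matroid_direct_sum:
  assumes "matroid E\<^sub>1 I\<^sub>1" "matroid E\<^sub>2 I\<^sub>2" and disj: "E\<^sub>1 \<inter> E\<^sub>2 = {}"
  shows "matroid (E\<^sub>1 \<union> E\<^sub>2) (direct_sum E\<^sub>1 I\<^sub>1 E\<^sub>2 I\<^sub>2)"
proof -
  interpret M1: matroid E\<^sub>1 I\<^sub>1 by fact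
  interpret M2: matroid E\<^sub>2 I\<^sub>2 by fact
  show ?thesis
  proof
    show "finite (E\<^sub>1 \<union> E\<^sub>2)" using M1.finite_ground M2.finite_ground by simp
    show "X \<subseteq> E\<^sub>1 \<union> E\<^sub>2" if "direct_sum E\<^sub>1 I\<^sub>1 E\<^sub>2 I\<^sub>2 X" for X
      using that by (simp add: direct_sum_def)
    show "direct_sum E\<^sub>1 I\<^sub>1 E\<^sub>2 I\<^sub>2 {}"
      by (simp add: direct_sum_def M1.indep_empty M2.indep_empty)
    show "direct_sum E\<^sub>1 I\<^sub>1 E\<^sub>2 I\<^sub>2 Y" if "direct_sum E\<^sub>1 I\<^sub>1 E\<^sub>2 I\<^sub>2 X" "Y \<subseteq> X" for X Y
      using that M1.indep_subset[of "X \<inter> E\<^sub>1" "Y \<inter> E\<^sub>1"] M2.indep_subset[of "X \<inter> E\<^sub>2" "Y \<inter> E\<^sub>2"]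
      unfolding direct_sum_def by blast
    fix X Y
    assume X: "direct_sum E\<^sub>1 I\<^sub>1 E\<^sub>2 I\<^sub>2 X" and Y: "direct_sum E\<^sub>1 I\<^sub>1 E\<^sub>2 I\<^sub>2 Y" and less: "card Y < card X"
    have card: "card Z = card (Z \<inter> E\<^sub>1) + card (Z \<inter> E\<^sub>2)" if "Z \<subseteq> E\<^sub>1 \<union> E\<^sub>2" for Z
    proof -
      have "Z = Z \<inter> E\<^sub>1 \<union> Z \<inter> E\<^sub>2" using that by blast
      moreover have "card (Z \<inter> E\<^sub>1 \<union> Z \<inter> E\<^sub>2) = card (Z \<inter> E\<^sub>1) + card (Z \<inter> E\<^sub>2)"
        using disj M1.finite_ground M2.finite_ground by (intro card_Un_disjoint) auto
      ultimately show ?thesis by simp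
    qed
    have "card Y = card (Y \<inter> E\<^sub>1) + card (Y \<inter> E\<^sub>2)" "card X = card (X \<inter> E\<^sub>1) + card (X \<inter> E\<^sub>2)"
      using X Y card by (auto simp: direct_sum_def)
    then consider "card (Y \<inter> E\<^sub>1) < card (X \<inter> E\<^sub>1)" | "card (Y \<inter> E\<^sub>2) < card (X \<inter> E\<^sub>2)"
      using less by linarith
    then show "\<exists>x\<in>X - Y. direct_sum E\<^sub>1 I\<^sub>1 E\<^sub>2 I\<^sub>2 (insert x Y)"
    proof cases
      case 1
      then obtain x where x: "x \<in> X \<inter> E\<^sub>1 - Y \<inter> E\<^sub>1" "I\<^sub>1 (insert x (Y \<inter> E\<^sub>1))"
        using M1.augment[of "X \<inter> E\<^sub>1" "Y \<inter> E\<^sub>1"] X Y by (auto simp: direct_sum_def)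
      moreover have "insert x Y \<inter> E\<^sub>1 = insert x (Y \<inter> E\<^sub>1)" "insert x Y \<inter> E\<^sub>2 = Y \<inter> E\<^sub>2"
        using x disj by auto
      ultimately show ?thesis using Y by (intro bexI[of _ x]) (auto simp: direct_sum_def)
    next
      case 2
      then obtain x where x: "x \<in> X \<inter> E\<^sub>2 - Y \<inter> E\<^sub>2" "I\<^sub>2 (insert x (Y \<inter> E\<^sub>2))"
        using M2.augment[of "X \<inter> E\<^sub>2" "Y \<inter> E\<^sub>2"] X Y by (auto simp: direct_sum_def)
      moreover have "insert x Y \<inter> E\<^sub>2 = insert x (Y \<inter> E\<^sub>2)" "insert x Y \<inter> E\<^sub>1 = Y \<inter> E\<^sub>1"
        using x disj by auto
      ultimately show ?thesis using Y by (intro bexI[of _ x]) (auto simp: direct_sum_def)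
    qed
  qed
qed

text \<open>One matrix restricts to the columns of either side. What matters later is that both
  summands are represented over the same field \<open>F\<close>, so that both characteristics are
  imposed on it.\<close>

lemma representable_over_direct_sumD:
  assumes M: "matroid E\<^sub>1 I\<^sub>1" "matroid E\<^sub>2 I\<^sub>2" and disj: "E\<^sub>1 \<inter> E\<^sub>2 = {}"
    and rep: "representable_over F (E\<^sub>1 \<union> E\<^sub>2) (direct_sum E\<^sub>1 I\<^sub>1 E\<^sub>2 I\<^sub>2)"
  shows "representable_over F E\<^sub>1 I\<^sub>1" "representable_over F E\<^sub>2 I\<^sub>2"
proof -
  obtain r A where A: "\<forall>i<r. \<forall>e\<in>E\<^sub>1 \<union> E\<^sub>2. A i e \<in> carrier F"
    and iff: "\<forall>X\<subseteq>E\<^sub>1 \<union> E\<^sub>2. direct_sum E\<^sub>1 I\<^sub>1 E\<^sub>2 I\<^sub>2 X \<longleftrightarrow> lin_indep_columns F r A X"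
    using rep unfolding representable_over_def by (elim exE conjE)
  have "I\<^sub>1 X \<longleftrightarrow> lin_indep_columns F r A X" if X: "X \<subseteq> E\<^sub>1" for X
  proof -
    have "X \<inter> E\<^sub>1 = X" "X \<inter> E\<^sub>2 = {}" "X \<subseteq> E\<^sub>1 \<union> E\<^sub>2" using X disj by auto
    then show ?thesis using iff[rule_format, of X] matroid.indep_empty[OF M(2)] by (simp add: direct_sum_def)
  qed
  then show "representable_over F E\<^sub>1 I\<^sub>1" using A unfolding representable_over_def by blast
  have "I\<^sub>2 X \<longleftrightarrow> lin_indep_columns F r A X" if X: "X \<subseteq> E\<^sub>2" for X
  proof -
    have "X \<inter> E\<^sub>2 = X" "X \<inter> E\<^sub>1 = {}" "X \<subseteq> E\<^sub>1 \<union> E\<^sub>2" using X disj by auto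
    then show ?thesis using iff[rule_format, of X] matroid.indep_empty[OF M(1)] by (simp add: direct_sum_def)
  qed
  then show "representable_over F E\<^sub>2 I\<^sub>2" using A unfolding representable_over_def by blast
qed

section \<open>Finitely many types of left summands (Feferman--Vaught composition)\<close>

text \<open>The induction on formulas builds types as pairs and as sets of earlier types, whereas
  its hypothesis can only speak of one HOL type of values. Since the range stays finite, the new
  types are recoded as naturals at every stage.\<close>

lemma finite_range_nat_code:
  assumes "finite (range f)"
  obtains g :: "'a \<Rightarrow> nat" where "finite (range g)" "\<And>x y. g x = g y \<Longrightarrow> f x = f y"
proof -
  obtain h :: "'b \<Rightarrow> nat" where h: "inj_on h (range f)"
    using finite_imp_inj_to_nat_seg[OF assms] by blast
  show ?thesis
  proof
    show "finite (range (h \<circ> f))" using finite_imageI[OF assms, of h] by (simp add: image_comp)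
    show "f x = f y" if "(h \<circ> f) x = (h \<circ> f) y" for x y
      using that h by (auto simp: inj_on_def)
  qed
qed

text \<open>An interchangeability condition: left structures with equal value of \<open>t\<close>
  may replace each other beside any right structure. A single \<open>t\<close> serves all
  \<open>D\<close>, \<open>J\<close> and \<open>\<eta>\<close>; finiteness and disjointness make
  \<open>card\<close> additive and the splitting of sets unique.\<close>

definition left_determines :: "('e set \<times> ('e set \<Rightarrow> bool) \<times> (nat \<Rightarrow> 'e set) \<Rightarrow> 'c) \<Rightarrow> fm \<Rightarrow> bool" where
  "left_determines t \<psi> \<longleftrightarrow>
     (\<forall>E I \<theta> E' I' \<theta>' D J \<eta>.
        finite E \<and> finite E' \<and> finite D \<and> E \<inter> D = {} \<and> E' \<inter> D = {} \<and>
        (\<forall>i. \<theta> i \<subseteq> E) \<and> (\<forall>i. \<theta>' i \<subseteq> E') \<and> (\<forall>i. \<eta> i \<subseteq> D) \<and> t (E, I, \<theta>) = t (E', I', \<theta>') \<longrightarrow>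
        holds (E \<union> D) (direct_sum E I D J) \<psi> (\<lambda>i. \<theta> i \<union> \<eta> i) =
        holds (E' \<union> D) (direct_sum E' I' D J) \<psi> (\<lambda>i. \<theta>' i \<union> \<eta> i))"

text \<open>The conditions are symmetric in the two left structures, so one implication yields the
  equivalence.\<close>

lemma left_determinesI:
  assumes "\<And>E I \<theta> E' I' \<theta>' D J \<eta>. \<lbrakk>finite E; finite E'; finite D; E \<inter> D = {}; E' \<inter> D = {};
      \<And>i. \<theta> i \<subseteq> E; \<And>i. \<theta>' i \<subseteq> E'; \<And>i. \<eta> i \<subseteq> D; t (E, I, \<theta>) = t (E', I', \<theta>');
      holds (E \<union> D) (direct_sum E I D J) \<psi> (\<lambda>i. \<theta> i \<union> \<eta> i)\<rbrakk> \<Longrightarrow>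
      holds (E' \<union> D) (direct_sum E' I' D J) \<psi> (\<lambda>i. \<theta>' i \<union> \<eta> i)"
  shows "left_determines t \<psi>"
  unfolding left_determines_def
  by (intro allI impI iffI; elim conjE) (rule assms; (blast | simp))+

lemma left_determinesD:
  assumes "left_determines t \<psi>" "t (E, I, \<theta>) = t (E', I', \<theta>')"
    "finite E" "finite E'" "finite D" "E \<inter> D = {}" "E' \<inter> D = {}"
    "\<And>i. \<theta> i \<subseteq> E" "\<And>i. \<theta>' i \<subseteq> E'" "\<And>i. \<eta> i \<subseteq> D"
  shows "holds (E \<union> D) (direct_sum E I D J) \<psi> (\<lambda>i. \<theta> i \<union> \<eta> i) \<longleftrightarrow>
    holds (E' \<union> D) (direct_sum E' I' D J) \<psi> (\<lambda>i. \<theta>' i \<union> \<eta> i)"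
  using assms unfolding left_determines_def by blast

lemma left_determines_finer:
  assumes t: "left_determines t \<psi>" and g: "\<And>x y. g x = g y \<Longrightarrow> t x = t y"
  shows "left_determines g \<psi>"
proof (rule left_determinesI)
  fix E E' D :: "'a set" and I I' J and \<theta> \<theta>' \<eta> :: "nat \<Rightarrow> 'a set"
  assume *: "finite E" "finite E'" "finite D" "E \<inter> D = {}" "E' \<inter> D = {}"
    "\<And>i. \<theta> i \<subseteq> E" "\<And>i. \<theta>' i \<subseteq> E'" "\<And>i. \<eta> i \<subseteq> D" and eq: "g (E, I, \<theta>) = g (E', I', \<theta>')"
    and holds: "holds (E \<union> D) (direct_sum E I D J) \<psi> (\<lambda>i. \<theta> i \<union> \<eta> i)"
  show "holds (E' \<union> D) (direct_sum E' I' D J) \<psi> (\<lambda>i. \<theta>' i \<union> \<eta> i)"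
    using left_determinesD[OF t g[OF eq] *, of J] holds by simp
qed

text \<open>One back-and-forth step: equal sets of reachable types mean that any choice of the left
  part of a witness is answered by a choice of the same \<open>t\<close>-type in the other
  structure, while the right part of the witness is kept.\<close>

lemma left_determines_Exists:
  assumes t: "left_determines t \<psi>"
  shows "left_determines (\<lambda>(E, I, \<theta>). (\<lambda>X. t (E, I, \<theta>(i := X))) ` Pow E) (Exists i \<psi>)"
proof (rule left_determinesI)
  fix E E' D :: "'a set" and I I' J and \<theta> \<theta>' \<eta> :: "nat \<Rightarrow> 'a set"
  assume fin: "finite E" "finite E'" "finite D" and disj: "E \<inter> D = {}" "E' \<inter> D = {}"
    and sub: "\<And>i. \<theta> i \<subseteq> E" "\<And>i. \<theta>' i \<subseteq> E'" "\<And>i. \<eta> i \<subseteq> D"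
    and eq: "(case (E, I, \<theta>) of (E, I, \<theta>) \<Rightarrow> (\<lambda>X. t (E, I, \<theta>(i := X))) ` Pow E) =
      (case (E', I', \<theta>') of (E, I, \<theta>) \<Rightarrow> (\<lambda>X. t (E, I, \<theta>(i := X))) ` Pow E)"
    and holds: "holds (E \<union> D) (direct_sum E I D J) (Exists i \<psi>) (\<lambda>i. \<theta> i \<union> \<eta> i)"
  \<comment> \<open>Updating a merged assignment amounts to merging two updated assignments; this
    lets the witness be distributed over the two sides.\<close>
  have upd: "(\<lambda>j. \<theta> j \<union> \<eta> j)(i := X \<union> Y) = (\<lambda>j. (\<theta>(i := X)) j \<union> (\<eta>(i := Y)) j)"
    for \<theta> \<eta> :: "nat \<Rightarrow> 'a set" and X Y by (simp add: fun_eq_iff)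
  obtain Z where Z: "Z \<subseteq> E \<union> D"
    "holds (E \<union> D) (direct_sum E I D J) \<psi> ((\<lambda>i. \<theta> i \<union> \<eta> i)(i := Z))"
    using holds by auto
  define X Y where "X = Z \<inter> E" and "Y = Z \<inter> D"
  have ZXY: "Z = X \<union> Y" using Z(1) by (auto simp: X_def Y_def)
  have "t (E, I, \<theta>(i := X)) \<in> (\<lambda>X. t (E', I', \<theta>'(i := X))) ` Pow E'"
    using eq by (auto simp: X_def)
  then obtain X' where X': "X' \<subseteq> E'" "t (E, I, \<theta>(i := X)) = t (E', I', \<theta>'(i := X'))" by blast
  have "holds (E' \<union> D) (direct_sum E' I' D J) \<psi> (\<lambda>j. (\<theta>'(i := X')) j \<union> (\<eta>(i := Y)) j)"
    using left_determinesD[OF t X'(2) fin disj, of "\<eta>(i := Y)" J] Z(2) X'(1) sub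
    unfolding ZXY upd by (auto simp: X_def Y_def)
  moreover have "X' \<union> Y \<subseteq> E' \<union> D" using X'(1) by (auto simp: Y_def)
  ultimately show "holds (E' \<union> D) (direct_sum E' I' D J) (Exists i \<psi>) (\<lambda>i. \<theta>' i \<union> \<eta> i)"
    unfolding upd[symmetric] holds.simps by blast
qed

lemma left_determines_Neg: "left_determines t \<psi> \<Longrightarrow> left_determines t (Neg \<psi>)"
  unfolding left_determines_def by simp

text \<open>Types grow along the formula: a bounded number for an atom, pairs for a conjunction,
  sets of types for a quantifier. Each construction keeps the range finite.\<close>

lemma finite_left_types:
  "\<exists>t :: 'e set \<times> ('e set \<Rightarrow> bool) \<times> (nat \<Rightarrow> 'e set) \<Rightarrow> nat. finite (range t) \<and> left_determines t \<psi>"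
proof (induction \<psi>)
  case (Subset i j)
  let ?t = "\<lambda>(E :: 'e set, I :: 'e set \<Rightarrow> bool, \<theta> :: nat \<Rightarrow> 'e set). (of_bool (\<theta> i \<subseteq> \<theta> j) :: nat)"
  have "range ?t \<subseteq> {..1}" by auto
  then have "finite (range ?t)" by (rule finite_subset) simp
  moreover have "left_determines ?t (Subset i j)"
  proof (rule left_determinesI)
    fix E E' D :: "'e set" and I I' J and \<theta> \<theta>' \<eta> :: "nat \<Rightarrow> 'e set"
    assume *: "E \<inter> D = {}" "\<And>i. \<theta> i \<subseteq> E" "\<And>i. \<eta> i \<subseteq> D"
      "?t (E, I, \<theta>) = ?t (E', I', \<theta>')"
      "holds (E \<union> D) (direct_sum E I D J) (Subset i j) (\<lambda>i. \<theta> i \<union> \<eta> i)"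
    have "\<theta> i \<union> \<eta> i \<subseteq> \<theta> j \<union> \<eta> j" using *(5) by simp
    then have "\<theta> i \<subseteq> \<theta> j" "\<eta> i \<subseteq> \<eta> j" using *(1) *(2)[of i] *(2)[of j] *(3)[of i] *(3)[of j] by blast+
    moreover have "\<theta> i \<subseteq> \<theta> j \<longleftrightarrow> \<theta>' i \<subseteq> \<theta>' j" using *(4) by (simp add: of_bool_eq_iff)
    ultimately have "\<theta>' i \<subseteq> \<theta>' j" "\<eta> i \<subseteq> \<eta> j" by simp_all
    then show "holds (E' \<union> D) (direct_sum E' I' D J) (Subset i j) (\<lambda>i. \<theta>' i \<union> \<eta> i)" by auto
  qed
  ultimately show ?case by blast
next
  case (Sing i)
  \<comment> \<open>The cap 2 suffices: whether \<open>card (\<theta> i) + card (\<eta> i)\<close>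
    is 1 depends only on whether the first summand is 0, 1 or larger.\<close>
  let ?t = "\<lambda>(E :: 'e set, I :: 'e set \<Rightarrow> bool, \<theta> :: nat \<Rightarrow> 'e set). min 2 (card (\<theta> i))"
  have "range ?t \<subseteq> {..2}" by auto
  then have "finite (range ?t)" by (rule finite_subset) simp
  moreover have "left_determines ?t (Sing i)"
  proof (rule left_determinesI)
    fix E E' D :: "'e set" and I I' J and \<theta> \<theta>' \<eta> :: "nat \<Rightarrow> 'e set"
    assume *: "finite E" "finite E'" "finite D" "E \<inter> D = {}" "E' \<inter> D = {}"
      "\<And>i. \<theta> i \<subseteq> E" "\<And>i. \<theta>' i \<subseteq> E'" "\<And>i. \<eta> i \<subseteq> D"
      "?t (E, I, \<theta>) = ?t (E', I', \<theta>')"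
      "holds (E \<union> D) (direct_sum E I D J) (Sing i) (\<lambda>i. \<theta> i \<union> \<eta> i)"
    have "card (\<theta> i \<union> \<eta> i) = card (\<theta> i) + card (\<eta> i)"
      using *(1,3,4) *(6)[of i] *(8)[of i] by (intro card_Un_disjoint) (auto intro: finite_subset)
    moreover have "card (\<theta>' i \<union> \<eta> i) = card (\<theta>' i) + card (\<eta> i)"
      using *(2,3,5) *(7)[of i] *(8)[of i] by (intro card_Un_disjoint) (auto intro: finite_subset)
    ultimately show "holds (E' \<union> D) (direct_sum E' I' D J) (Sing i) (\<lambda>i. \<theta>' i \<union> \<eta> i)"
      using *(9,10) by (simp add: min_def split: if_splits)
  qed
  ultimately show ?case by blast
next
  case (Ind i)
  let ?t = "\<lambda>(E :: 'e set, I :: 'e set \<Rightarrow> bool, \<theta> :: nat \<Rightarrow> 'e set). (of_bool (I (\<theta> i)) :: nat)"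
  have "range ?t \<subseteq> {..1}" by auto
  then have "finite (range ?t)" by (rule finite_subset) simp
  moreover have "left_determines ?t (Ind i)"
  proof (rule left_determinesI)
    fix E E' D :: "'e set" and I I' J and \<theta> \<theta>' \<eta> :: "nat \<Rightarrow> 'e set"
    assume *: "E \<inter> D = {}" "E' \<inter> D = {}" "\<And>i. \<theta> i \<subseteq> E" "\<And>i. \<theta>' i \<subseteq> E'" "\<And>i. \<eta> i \<subseteq> D"
      "?t (E, I, \<theta>) = ?t (E', I', \<theta>')"
      "holds (E \<union> D) (direct_sum E I D J) (Ind i) (\<lambda>i. \<theta> i \<union> \<eta> i)"
    have "(\<theta> i \<union> \<eta> i) \<inter> E = \<theta> i" "(\<theta> i \<union> \<eta> i) \<inter> D = \<eta> i"
      "(\<theta>' i \<union> \<eta> i) \<inter> E' = \<theta>' i" "(\<theta>' i \<union> \<eta> i) \<inter> D = \<eta> i" "\<theta>' i \<union> \<eta> i \<subseteq> E' \<union> D"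
      using *(1,2) *(3)[of i] *(4)[of i] *(5)[of i] by blast+
    then show "holds (E' \<union> D) (direct_sum E' I' D J) (Ind i) (\<lambda>i. \<theta>' i \<union> \<eta> i)"
      using *(6,7) by (simp add: direct_sum_def of_bool_eq_iff)
  qed
  ultimately show ?case by blast
next
  case (Neg \<psi>)
  then show ?case using left_determines_Neg by blast
next
  case (Conj \<psi>\<^sub>1 \<psi>\<^sub>2)
  then obtain t\<^sub>1 t\<^sub>2 :: "'e set \<times> ('e set \<Rightarrow> bool) \<times> (nat \<Rightarrow> 'e set) \<Rightarrow> nat"
    where t: "finite (range t\<^sub>1)" "left_determines t\<^sub>1 \<psi>\<^sub>1" "finite (range t\<^sub>2)" "left_determines t\<^sub>2 \<psi>\<^sub>2"
    by blast
  have "range (\<lambda>s. (t\<^sub>1 s, t\<^sub>2 s)) \<subseteq> range t\<^sub>1 \<times> range t\<^sub>2" by auto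
  then have "finite (range (\<lambda>s. (t\<^sub>1 s, t\<^sub>2 s)))" using t by (meson finite_SigmaI finite_subset)
  then obtain g :: "_ \<Rightarrow> nat" where g: "finite (range g)" "\<And>x y. g x = g y \<Longrightarrow> (t\<^sub>1 x, t\<^sub>2 x) = (t\<^sub>1 y, t\<^sub>2 y)"
    by (rule finite_range_nat_code) blast
  have "left_determines g (Conj \<psi>\<^sub>1 \<psi>\<^sub>2)"
  proof (rule left_determinesI)
    fix E E' D :: "'e set" and I I' J and \<theta> \<theta>' \<eta> :: "nat \<Rightarrow> 'e set"
    assume *: "finite E" "finite E'" "finite D" "E \<inter> D = {}" "E' \<inter> D = {}"
      "\<And>i. \<theta> i \<subseteq> E" "\<And>i. \<theta>' i \<subseteq> E'" "\<And>i. \<eta> i \<subseteq> D"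
      "g (E, I, \<theta>) = g (E', I', \<theta>')"
      "holds (E \<union> D) (direct_sum E I D J) (Conj \<psi>\<^sub>1 \<psi>\<^sub>2) (\<lambda>i. \<theta> i \<union> \<eta> i)"
    have eq: "t\<^sub>1 (E, I, \<theta>) = t\<^sub>1 (E', I', \<theta>')" "t\<^sub>2 (E, I, \<theta>) = t\<^sub>2 (E', I', \<theta>')"
      using g(2)[OF *(9)] by auto
    show "holds (E' \<union> D) (direct_sum E' I' D J) (Conj \<psi>\<^sub>1 \<psi>\<^sub>2) (\<lambda>i. \<theta>' i \<union> \<eta> i)"
      using left_determinesD[OF t(2) eq(1) *(1-8), of J] left_determinesD[OF t(4) eq(2) *(1-8), of J]
        *(10) by simp
  qed
  then show ?case using g(1) by blast
next
  case (Exists i \<psi>)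
  show ?case
  proof -
    obtain t :: "'e set \<times> ('e set \<Rightarrow> bool) \<times> (nat \<Rightarrow> 'e set) \<Rightarrow> nat"
      where t: "finite (range t)" "left_determines t \<psi>" using Exists by blast
    define f where "f = (\<lambda>(E, I, \<theta>). (\<lambda>X. t (E, I, \<theta>(i := X))) ` Pow E)"
    have "range f \<subseteq> Pow (range t)" by (auto simp: f_def)
    then have "finite (range f)" using t(1) by (meson finite_Pow_iff finite_subset)
    then obtain g :: "_ \<Rightarrow> nat" where g: "finite (range g)" "\<And>x y. g x = g y \<Longrightarrow> f x = f y"
      by (rule finite_range_nat_code) blast
    have "left_determines f (Exists i \<psi>)" unfolding f_def by (rule left_determines_Exists[OF t(2)])
    then have "left_determines g (Exists i \<psi>)"
      by (rule left_determines_finer) (rule g(2))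
    then show ?thesis using g(1) by blast
  qed
next
  case (Forall i \<psi>)
  show ?case
  proof -
    obtain t :: "'e set \<times> ('e set \<Rightarrow> bool) \<times> (nat \<Rightarrow> 'e set) \<Rightarrow> nat"
      where t: "finite (range t)" "left_determines t \<psi>" using Forall by blast
    define f where "f = (\<lambda>(E, I, \<theta>). (\<lambda>X. t (E, I, \<theta>(i := X))) ` Pow E)"
    have "range f \<subseteq> Pow (range t)" by (auto simp: f_def)
    then have "finite (range f)" using t(1) by (meson finite_Pow_iff finite_subset)
    then obtain g :: "_ \<Rightarrow> nat" where g: "finite (range g)" "\<And>x y. g x = g y \<Longrightarrow> f x = f y"
      by (rule finite_range_nat_code) blast
    \<comment> \<open>The universal quantifier is handled as the dual of the existential one, with
      the same type map \<open>f\<close>.\<close>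
    have "left_determines f (Neg (Exists i (Neg \<psi>)))"
      unfolding f_def by (intro left_determines_Neg left_determines_Exists t)
    then have "left_determines f (Forall i \<psi>)" by (simp add: left_determines_def)
    then have "left_determines g (Forall i \<psi>)"
      by (rule left_determines_finer) (rule g(2))
    then show ?thesis using g(1) by blast
  qed
qed

section \<open>Vector matroids over prime fields\<close>

text \<open>Linear independence over the field of \<open>p\<close> elements, phrased with integer
  coefficients and divisibility so that ordinary integer sums can be used;
  \<open>lin_indep_columns_residue_ring\<close> links it to the residue ring.\<close>

definition indep_mod :: "int \<Rightarrow> nat \<Rightarrow> (nat \<Rightarrow> 'e \<Rightarrow> int) \<Rightarrow> 'e set \<Rightarrow> bool" where
  "indep_mod p r A X \<longleftrightarrow>
     (\<forall>c. (\<forall>i<r. p dvd (\<Sum>e\<in>X. c e * A i e)) \<longrightarrow> (\<forall>e\<in>X. p dvd c e))"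

lemma indep_modD:
  "indep_mod p r A X \<Longrightarrow> (\<And>i. i < r \<Longrightarrow> p dvd (\<Sum>e\<in>X. c e * A i e)) \<Longrightarrow> e \<in> X \<Longrightarrow> p dvd c e"
  unfolding indep_mod_def by blast

text \<open>Gaussian elimination: an equation with a coefficient not divisible by \<open>p\<close>
  eliminates one unknown, and an equation without one holds trivially.\<close>

lemma underdetermined_system_mod:
  fixes p :: int
  assumes p: "prime p"
  shows "finite Y \<Longrightarrow> finite X \<Longrightarrow> card Y < card X \<Longrightarrow>
    \<exists>c. (\<forall>y\<in>Y. p dvd (\<Sum>x\<in>X. c x * M y x)) \<and> (\<exists>x\<in>X. \<not> p dvd c x)"
proof (induction Y arbitrary: X M rule: finite_induct)
  case empty
  then obtain x where "x \<in> X" by fastforce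
  then show ?case using p by (intro exI[of _ "\<lambda>_. 1"]) (auto simp: prime_int_iff)
next
  case (insert y Y)
  show ?case
  proof (cases "\<forall>x\<in>X. p dvd M y x")
    case True
    obtain c where "\<forall>y\<in>Y. p dvd (\<Sum>x\<in>X. c x * M y x)" "\<exists>x\<in>X. \<not> p dvd c x"
      using insert.IH[of X M] insert.prems insert.hyps by auto
    then show ?thesis using True by (intro exI[of _ c]) (auto intro!: dvd_sum)
  next
    case False
    then obtain x\<^sub>0 where x0: "x\<^sub>0 \<in> X" "\<not> p dvd M y x\<^sub>0" by blast
    define X' where "X' = X - {x\<^sub>0}"
    \<comment> \<open>Fraction-free elimination with pivot \<open>M y x\<^sub>0\<close>: rows are
      cross-multiplied, so no inverse modulo \<open>p\<close> is taken. The solution is scaled by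
      the pivot accordingly, and the value of \<open>d\<close> at \<open>x\<^sub>0\<close> makes
      equation \<open>y\<close> hold exactly.\<close>
    define M' where "M' z x = M y x\<^sub>0 * M z x - M z x\<^sub>0 * M y x" for z x
    have X': "finite X'" "card Y < card X'"
      using insert x0 by (auto simp: X'_def)
    then obtain c where c: "\<forall>z\<in>Y. p dvd (\<Sum>x\<in>X'. c x * M' z x)" "\<exists>x\<in>X'. \<not> p dvd c x"
      using insert.IH[of X' M'] by blast
    define d where "d x = (if x = x\<^sub>0 then - (\<Sum>x\<in>X'. c x * M y x) else M y x\<^sub>0 * c x)" for x
    have sum: "(\<Sum>x\<in>X. d x * M z x) = (\<Sum>x\<in>X'. c x * M' z x)" for z
    proof -
      have "(\<Sum>x\<in>X. d x * M z x) = d x\<^sub>0 * M z x\<^sub>0 + (\<Sum>x\<in>X'. d x * M z x)"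
        unfolding X'_def using insert.prems x0 by (simp add: sum.remove)
      also have "(\<Sum>x\<in>X'. d x * M z x) = (\<Sum>x\<in>X'. M y x\<^sub>0 * c x * M z x)"
        by (rule sum.cong) (auto simp: d_def X'_def)
      finally show ?thesis
        by (simp add: d_def M'_def algebra_simps sum_subtractf sum_distrib_left sum_distrib_right)
    qed
    have "p dvd (\<Sum>x\<in>X. d x * M z x)" if "z \<in> insert y Y" for z
      using that c(1) unfolding sum by (cases "z = y") (auto simp: M'_def)
    moreover obtain x where "x \<in> X'" "\<not> p dvd c x" using c(2) by blast
    then have "x \<in> X" "\<not> p dvd d x"
      using x0 p by (auto simp: X'_def d_def prime_dvd_mult_iff)
    ultimately show ?thesis by blast
  qed
qed

lemma indep_mod_mono:
  assumes "finite X" "Y \<subseteq> X" "indep_mod p r A X"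
  shows "indep_mod p r A Y"
  unfolding indep_mod_def
proof (intro allI impI ballI)
  fix c e assume c: "\<forall>i<r. p dvd (\<Sum>e\<in>Y. c e * A i e)" and e: "e \<in> Y"
  let ?d = "\<lambda>e. if e \<in> Y then c e else 0"
  have "(\<Sum>e\<in>X. ?d e * A i e) = (\<Sum>e\<in>Y. c e * A i e)" for i
    using assms by (intro sum.mono_neutral_cong_right) auto
  then have "p dvd ?d e"
    using indep_modD[OF assms(3), of ?d e] c e assms(2) by auto
  then show "p dvd c e" using e by simp
qed

text \<open>If no element of \<open>X - Y\<close> extends \<open>Y\<close>, each such
  \<open>x\<close> has a relation \<open>w x\<close> on \<open>insert x Y\<close> that involves
  \<open>x\<close>. Cancelling the coefficients on \<open>Y - X\<close> takes fewer equations than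
  there are relations to combine, so some nontrivial combination is a relation on \<open>X\<close>
  alone, against its independence.\<close>

lemma indep_mod_augment:
  fixes p :: int
  assumes p: "prime p" and fin: "finite X" "finite Y"
    and X: "indep_mod p r A X" and Y: "indep_mod p r A Y" and less: "card Y < card X"
  shows "\<exists>x\<in>X - Y. indep_mod p r A (insert x Y)"
proof (rule ccontr)
  assume contra: "\<not> ?thesis"
  have "\<exists>w. (\<forall>i<r. p dvd (\<Sum>e\<in>X\<union>Y. w e * A i e)) \<and> (\<forall>e. e \<notin> insert x Y \<longrightarrow> w e = 0) \<and> \<not> p dvd w x"
    if x: "x \<in> X - Y" for x
  proof -
    obtain c where c: "\<And>i. i < r \<Longrightarrow> p dvd (\<Sum>e\<in>insert x Y. c e * A i e)" "\<exists>e\<in>insert x Y. \<not> p dvd c e"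
      using contra x unfolding indep_mod_def by meson
    have "\<not> p dvd c x"
    proof
      assume cx: "p dvd c x"
      have "p dvd (\<Sum>e\<in>Y. c e * A i e)" if "i < r" for i
        using c(1)[OF that] x fin cx by (simp add: dvd_add_right_iff)
      then have "\<forall>e\<in>Y. p dvd c e" using indep_modD[OF Y, of c] by blast
      then show False using c(2) cx by auto
    qed
    moreover have "(\<Sum>e\<in>X\<union>Y. (if e \<in> insert x Y then c e else 0) * A i e)
        = (\<Sum>e\<in>insert x Y. c e * A i e)" for i
      using x fin by (intro sum.mono_neutral_cong_right) auto
    ultimately show ?thesis
      using c(1) by (intro exI[of _ "\<lambda>e. if e \<in> insert x Y then c e else 0"]) simp
  qed
  then obtain w where w: "\<And>x i. x \<in> X - Y \<Longrightarrow> i < r \<Longrightarrow> p dvd (\<Sum>e\<in>X\<union>Y. w x e * A i e)"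
    "\<And>x e. x \<in> X - Y \<Longrightarrow> e \<notin> insert x Y \<Longrightarrow> w x e = 0" "\<And>x. x \<in> X - Y \<Longrightarrow> \<not> p dvd w x x"
    by metis
  have "card (Y - X) < card (X - Y)" using fin less by (simp add: card_less_sym_Diff)
  then obtain c where c: "\<forall>y\<in>Y - X. p dvd (\<Sum>x\<in>X - Y. c x * w x y)" "\<exists>x\<in>X - Y. \<not> p dvd c x"
    using underdetermined_system_mod[OF p, of "Y - X" "X - Y" "\<lambda>y x. w x y"] fin by auto
  define d where "d e = (\<Sum>x\<in>X - Y. c x * w x e)" for e
  have "p dvd (\<Sum>e\<in>X. d e * A i e)" if i: "i < r" for i
  proof -
    have "(\<Sum>e\<in>X\<union>Y. d e * A i e) = (\<Sum>e\<in>X\<union>Y. \<Sum>x\<in>X - Y. c x * w x e * A i e)"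
      by (simp add: d_def sum_distrib_right)
    also have "\<dots> = (\<Sum>x\<in>X - Y. c x * (\<Sum>e\<in>X\<union>Y. w x e * A i e))"
      by (subst sum.swap) (simp add: sum_distrib_left mult.assoc)
    finally have "p dvd (\<Sum>e\<in>X\<union>Y. d e * A i e)" using w(1) i by (auto intro!: dvd_sum)
    moreover have "(\<Sum>e\<in>X\<union>Y. d e * A i e) = (\<Sum>e\<in>X. d e * A i e) + (\<Sum>e\<in>Y - X. d e * A i e)"
      using fin by (subst sum.union_disjoint[symmetric]) auto
    moreover have "p dvd (\<Sum>e\<in>Y - X. d e * A i e)"
      using c(1) by (auto intro!: dvd_sum simp: d_def)
    ultimately show ?thesis by (metis dvd_add_left_iff)
  qed
  then have d: "p dvd d e" if "e \<in> X" for e using indep_modD[OF X] that by blast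
  obtain x where x: "x \<in> X - Y" "\<not> p dvd c x" using c(2) by blast
  \<comment> \<open>No other \<open>w z\<close> involves \<open>x\<close>, since \<open>x\<close>
    lies outside \<open>insert z Y\<close>; hence the coefficient \<open>c x * w x x\<close>
    survives.\<close>
  have "d x = (\<Sum>z\<in>{x}. c z * w z x)"
    unfolding d_def using x w(2) fin by (intro sum.mono_neutral_right) auto
  then show False using d[of x] x w(3)[of x] p by (simp add: prime_dvd_mult_iff)
qed

lemma indep_mod_image:
  assumes f: "inj f"
  shows "indep_mod p r (\<lambda>i e. A i (inv_into UNIV f e)) (f ` X) \<longleftrightarrow> indep_mod p r A X"
proof -
  have sum: "(\<Sum>e\<in>f ` X. c e * A i (inv_into UNIV f e)) = (\<Sum>x\<in>X. c (f x) * A i x)" for c i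
    using f by (subst sum.reindex) (auto intro: inj_on_subset)
  show ?thesis
  proof
    assume L: "indep_mod p r (\<lambda>i e. A i (inv_into UNIV f e)) (f ` X)"
    show "indep_mod p r A X"
      unfolding indep_mod_def
    proof (intro allI impI ballI)
      fix c x assume c: "\<forall>i<r. p dvd (\<Sum>x\<in>X. c x * A i x)" and x: "x \<in> X"
      have "p dvd c (inv_into UNIV f (f x))"
        by (rule indep_modD[OF L]) (use c x f in \<open>simp_all add: sum\<close>)
      then show "p dvd c x" using f by simp
    qed
  next
    assume L: "indep_mod p r A X"
    show "indep_mod p r (\<lambda>i e. A i (inv_into UNIV f e)) (f ` X)"
      unfolding indep_mod_def sum
    proof (intro allI impI ballI)
      fix c e assume c: "\<forall>i<r. p dvd (\<Sum>x\<in>X. c (f x) * A i x)" and e: "e \<in> f ` X"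
      obtain x where x: "x \<in> X" "e = f x" using e by blast
      have "p dvd c (f x)" by (rule indep_modD[OF L]) (use c x in auto)
      then show "p dvd c e" using x by simp
    qed
  qed
qed

lemma matroid_indep_mod:
  assumes "prime p" "finite E"
  shows "matroid E (\<lambda>X. X \<subseteq> E \<and> indep_mod p r A X)"
proof
  show "\<exists>x\<in>X - Y. insert x Y \<subseteq> E \<and> indep_mod p r A (insert x Y)"
    if "X \<subseteq> E \<and> indep_mod p r A X" "Y \<subseteq> E \<and> indep_mod p r A Y" "card Y < card X" for X Y
    using indep_mod_augment[OF assms(1), of X Y r A] that assms(2) by (blast intro: finite_subset)
  show "Y \<subseteq> E \<and> indep_mod p r A Y" if "X \<subseteq> E \<and> indep_mod p r A X" "Y \<subseteq> X" for X Y
    using that assms(2) indep_mod_mono[of X Y p r A] by (blast intro: finite_subset)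
qed (use assms in \<open>auto simp: indep_mod_def\<close>)

lemma lin_indep_columns_residue_ring:
  assumes p: "1 < p" and X: "finite X"
  shows "lin_indep_columns (residue_ring p) r (\<lambda>i e. A i e mod p) X \<longleftrightarrow> indep_mod p r A X"
proof -
  interpret residues p "residue_ring p" by unfold_locales (use p in auto)
  have sum: "(\<Oplus>\<^bsub>residue_ring p\<^esub>e\<in>X. (c e mod p) \<otimes>\<^bsub>residue_ring p\<^esub> (A i e mod p)) = \<zero>\<^bsub>residue_ring p\<^esub>
      \<longleftrightarrow> p dvd (\<Sum>e\<in>X. c e * A i e)" for c i
    by (simp add: mult_cong sum_cong[OF X] res_zero_eq dvd_eq_mod_eq_0)
  show ?thesis
  proof
    assume L: "lin_indep_columns (residue_ring p) r (\<lambda>i e. A i e mod p) X"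
    show "indep_mod p r A X"
      unfolding indep_mod_def
    proof (intro allI impI ballI)
      fix c e assume "\<forall>i<r. p dvd (\<Sum>e\<in>X. c e * A i e)" "e \<in> X"
      moreover have "(\<lambda>e. c e mod p) \<in> X \<rightarrow> carrier (residue_ring p)" by auto
      ultimately have "c e mod p = \<zero>\<^bsub>residue_ring p\<^esub>"
        using L sum[of c] unfolding lin_indep_columns_def
        by (auto dest!: bspec[where x = "\<lambda>e. c e mod p"])
      then show "p dvd c e" by (simp add: res_zero_eq dvd_eq_mod_eq_0)
    qed
  next
    assume L: "indep_mod p r A X"
    show "lin_indep_columns (residue_ring p) r (\<lambda>i e. A i e mod p) X"
      unfolding lin_indep_columns_def
    proof (intro ballI impI)
      fix c e assume c: "c \<in> X \<rightarrow> carrier (residue_ring p)" and e: "e \<in> X"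
        and z: "\<forall>i<r. (\<Oplus>\<^bsub>residue_ring p\<^esub>e\<in>X. c e \<otimes>\<^bsub>residue_ring p\<^esub> (A i e mod p)) = \<zero>\<^bsub>residue_ring p\<^esub>"
      have cm: "c e mod p = c e" if "e \<in> X" for e
        using c that by (auto simp: res_carrier_eq Pi_iff)
      have "(\<Oplus>\<^bsub>residue_ring p\<^esub>e\<in>X. c e \<otimes>\<^bsub>residue_ring p\<^esub> (A i e mod p))
          = (\<Oplus>\<^bsub>residue_ring p\<^esub>e\<in>X. (c e mod p) \<otimes>\<^bsub>residue_ring p\<^esub> (A i e mod p))" for i
        by (rule finsum_cong') (auto simp: cm)
      then have "p dvd c e" using indep_modD[OF L, of c e] z sum[of c] e by simp
      then show "c e = \<zero>\<^bsub>residue_ring p\<^esub>" using cm[OF e] by (simp add: res_zero_eq dvd_eq_mod_eq_0)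
    qed
  qed
qed

text \<open>The residue ring of the integers is the representing field;
  \<open>representable_if_representable_over\<close> moves it to a carrier of naturals.\<close>

lemma representable_indep_mod:
  assumes p: "prime p" and fin: "finite E" and I: "\<And>X. X \<subseteq> E \<Longrightarrow> I X \<longleftrightarrow> indep_mod p r A X"
  shows "representable E I"
proof (rule representable_if_representable_over[OF fin])
  interpret residues_prime "nat p" "residue_ring p"
    by unfold_locales (use p prime_ge_0_int[OF p] in simp_all)
  show "field (residue_ring p)" by (rule is_field)
  have "1 < p" using p by (simp add: prime_int_iff)
  show "representable_over (residue_ring p) E I"
    unfolding representable_over_def
  proof (intro exI conjI allI impI ballI)
    show "A i e mod p \<in> carrier (residue_ring p)" for i e
      using \<open>1 < p\<close> by (simp add: residue_ring_def)
    show "I X \<longleftrightarrow> lin_indep_columns (residue_ring p) r (\<lambda>i e. A i e mod p) X" if "X \<subseteq> E" for X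
      using lin_indep_columns_residue_ring[OF \<open>1 < p\<close>] I that fin by (metis finite_subset)
  qed
qed

lemma representable_direct_sum_indep_mod:
  assumes p: "prime p" and fin: "finite E\<^sub>1" "finite E\<^sub>2" and disj: "E\<^sub>1 \<inter> E\<^sub>2 = {}"
  shows "representable (E\<^sub>1 \<union> E\<^sub>2) (direct_sum E\<^sub>1 (\<lambda>X. X \<subseteq> E\<^sub>1 \<and> indep_mod p r\<^sub>1 A\<^sub>1 X)
    E\<^sub>2 (\<lambda>X. X \<subseteq> E\<^sub>2 \<and> indep_mod p r\<^sub>2 A\<^sub>2 X))"
proof (rule representable_indep_mod[OF p])
  show "finite (E\<^sub>1 \<union> E\<^sub>2)" using fin by simp
  fix X assume X: "X \<subseteq> E\<^sub>1 \<union> E\<^sub>2"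
  \<comment> \<open>The block-diagonal matrix: the first \<open>r\<^sub>1\<close> rows belong to
    \<open>E\<^sub>1\<close>, the next \<open>r\<^sub>2\<close> rows to
    \<open>E\<^sub>2\<close>.\<close>
  define B where "B i e = (if i < r\<^sub>1 then if e \<in> E\<^sub>1 then A\<^sub>1 i e else 0 else if e \<in> E\<^sub>2 then A\<^sub>2 (i - r\<^sub>1) e else 0)" for i e
  have finX: "finite X" using X fin by (meson finite_Un finite_subset)
  have sum1: "(\<Sum>e\<in>X. c e * B i e) = (\<Sum>e\<in>X \<inter> E\<^sub>1. c e * A\<^sub>1 i e)" if "i < r\<^sub>1" for c i
    using that finX by (intro sum.mono_neutral_cong_right) (auto simp: B_def)
  have sum2: "(\<Sum>e\<in>X. c e * B (r\<^sub>1 + i) e) = (\<Sum>e\<in>X \<inter> E\<^sub>2. c e * A\<^sub>2 i e)" for c i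
    using finX by (intro sum.mono_neutral_cong_right) (auto simp: B_def)
  have all_less: "(\<forall>i<r\<^sub>1 + r\<^sub>2. P i) \<longleftrightarrow> (\<forall>i<r\<^sub>1. P i) \<and> (\<forall>i<r\<^sub>2. P (r\<^sub>1 + i))" for P
    by (metis add_less_cancel_left le_add_diff_inverse not_less trans_less_add1)
  have split: "(\<forall>i<r\<^sub>1 + r\<^sub>2. p dvd (\<Sum>e\<in>X. c e * B i e)) \<longleftrightarrow>
     (\<forall>i<r\<^sub>1. p dvd (\<Sum>e\<in>X \<inter> E\<^sub>1. c e * A\<^sub>1 i e)) \<and> (\<forall>i<r\<^sub>2. p dvd (\<Sum>e\<in>X \<inter> E\<^sub>2. c e * A\<^sub>2 i e))" for c
    unfolding all_less[of "\<lambda>i. p dvd (\<Sum>e\<in>X. c e * B i e)"] sum2 using sum1 by simp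
  have "indep_mod p (r\<^sub>1 + r\<^sub>2) B X \<longleftrightarrow> indep_mod p r\<^sub>1 A\<^sub>1 (X \<inter> E\<^sub>1) \<and> indep_mod p r\<^sub>2 A\<^sub>2 (X \<inter> E\<^sub>2)"
  proof (intro iffI conjI)
    assume L: "indep_mod p (r\<^sub>1 + r\<^sub>2) B X"
    show "indep_mod p r\<^sub>1 A\<^sub>1 (X \<inter> E\<^sub>1)"
      unfolding indep_mod_def
    proof (intro allI impI ballI)
      fix c e assume c: "\<forall>i<r\<^sub>1. p dvd (\<Sum>e\<in>X \<inter> E\<^sub>1. c e * A\<^sub>1 i e)" and e: "e \<in> X \<inter> E\<^sub>1"
      \<comment> \<open>Extending the coefficients by 0 to the other side makes the other block of
        equations trivial.\<close>
      let ?d = "\<lambda>e. if e \<in> E\<^sub>1 then c e else 0"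
      have "(\<Sum>e\<in>X \<inter> E\<^sub>1. ?d e * A\<^sub>1 i e) = (\<Sum>e\<in>X \<inter> E\<^sub>1. c e * A\<^sub>1 i e)" for i
        by (rule sum.cong) auto
      moreover have "(\<Sum>e\<in>X \<inter> E\<^sub>2. ?d e * A\<^sub>2 i e) = 0" for i
        using disj by (intro sum.neutral) auto
      ultimately have "\<forall>i<r\<^sub>1 + r\<^sub>2. p dvd (\<Sum>e\<in>X. ?d e * B i e)" unfolding split using c by simp
      then have "p dvd ?d e" using indep_modD[OF L, of ?d e] e by blast
      then show "p dvd c e" using e by simp
    qed
    show "indep_mod p r\<^sub>2 A\<^sub>2 (X \<inter> E\<^sub>2)"
      unfolding indep_mod_def
    proof (intro allI impI ballI)
      fix c e assume c: "\<forall>i<r\<^sub>2. p dvd (\<Sum>e\<in>X \<inter> E\<^sub>2. c e * A\<^sub>2 i e)" and e: "e \<in> X \<inter> E\<^sub>2"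
      let ?d = "\<lambda>e. if e \<in> E\<^sub>2 then c e else 0"
      have "(\<Sum>e\<in>X \<inter> E\<^sub>2. ?d e * A\<^sub>2 i e) = (\<Sum>e\<in>X \<inter> E\<^sub>2. c e * A\<^sub>2 i e)" for i
        by (rule sum.cong) auto
      moreover have "(\<Sum>e\<in>X \<inter> E\<^sub>1. ?d e * A\<^sub>1 i e) = 0" for i
        using disj by (intro sum.neutral) auto
      ultimately have "\<forall>i<r\<^sub>1 + r\<^sub>2. p dvd (\<Sum>e\<in>X. ?d e * B i e)" unfolding split using c by simp
      then have "p dvd ?d e" using indep_modD[OF L, of ?d e] e by blast
      then show "p dvd c e" using e by simp
    qed
  next
    assume L: "indep_mod p r\<^sub>1 A\<^sub>1 (X \<inter> E\<^sub>1) \<and> indep_mod p r\<^sub>2 A\<^sub>2 (X \<inter> E\<^sub>2)"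
    show "indep_mod p (r\<^sub>1 + r\<^sub>2) B X"
      unfolding indep_mod_def split
    proof (intro allI impI ballI)
      fix c e
      assume c: "(\<forall>i<r\<^sub>1. p dvd (\<Sum>e\<in>X \<inter> E\<^sub>1. c e * A\<^sub>1 i e)) \<and>
        (\<forall>i<r\<^sub>2. p dvd (\<Sum>e\<in>X \<inter> E\<^sub>2. c e * A\<^sub>2 i e))" and e: "e \<in> X"
      then show "p dvd c e"
        using X indep_modD[of p r\<^sub>1 A\<^sub>1 "X \<inter> E\<^sub>1" c e] indep_modD[of p r\<^sub>2 A\<^sub>2 "X \<inter> E\<^sub>2" c e] L
        by blast
    qed
  qed
  then show "direct_sum E\<^sub>1 (\<lambda>X. X \<subseteq> E\<^sub>1 \<and> indep_mod p r\<^sub>1 A\<^sub>1 X) E\<^sub>2 (\<lambda>X. X \<subseteq> E\<^sub>2 \<and> indep_mod p r\<^sub>2 A\<^sub>2 X) X \<longleftrightarrow>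
      indep_mod p (r\<^sub>1 + r\<^sub>2) B X"
    using X by (simp add: direct_sum_def)
qed

section \<open>Linear relations between columns\<close>

locale column_matrix = field R for R (structure) +
  fixes r :: nat and E :: "'e set" and A :: "nat \<Rightarrow> 'e \<Rightarrow> 'a"
  assumes finite_columns: "finite E"
    and entry_closed: "i < r \<Longrightarrow> e \<in> E \<Longrightarrow> A i e \<in> carrier R"
begin

text \<open>Kernel vectors of the matrix, indexed by all of \<open>E\<close>. Relations with
  different supports can thus be added and scaled freely, and a support is expressed by vanishing
  outside a set.\<close>

definition relation :: "('e \<Rightarrow> 'a) \<Rightarrow> bool" where
  "relation w \<longleftrightarrow> w \<in> E \<rightarrow> carrier R \<and> (\<forall>i<r. (\<Oplus>e\<in>E. w e \<otimes> A i e) = \<zero>)"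

lemma relation_closed: "relation w \<Longrightarrow> e \<in> E \<Longrightarrow> w e \<in> carrier R"
  by (auto simp: relation_def)

lemma relation_scale:
  assumes "relation w" "a \<in> carrier R"
  shows "relation (\<lambda>e. a \<otimes> w e)"
proof -
  have "(\<Oplus>e\<in>E. a \<otimes> w e \<otimes> A i e) = \<zero>" if i: "i < r" for i
  proof -
    have "(\<Oplus>e\<in>E. a \<otimes> w e \<otimes> A i e) = (\<Oplus>e\<in>E. a \<otimes> (w e \<otimes> A i e))"
      using assms entry_closed[OF i] by (intro finsum_cong') (auto simp: m_assoc relation_closed)
    also have "\<dots> = a \<otimes> (\<Oplus>e\<in>E. w e \<otimes> A i e)"
      using assms entry_closed[OF i] finite_columns
      by (intro finsum_rdistr[symmetric]) (auto simp: relation_closed)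
    finally show ?thesis using assms i by (simp add: relation_def)
  qed
  then show ?thesis using assms by (auto simp: relation_def)
qed

lemma relation_add:
  assumes "relation w" "relation w'"
  shows "relation (\<lambda>e. w e \<oplus> w' e)"
proof -
  have "(\<Oplus>e\<in>E. (w e \<oplus> w' e) \<otimes> A i e) = \<zero>" if i: "i < r" for i
  proof -
    have "(\<Oplus>e\<in>E. (w e \<oplus> w' e) \<otimes> A i e) = (\<Oplus>e\<in>E. w e \<otimes> A i e \<oplus> w' e \<otimes> A i e)"
      using assms entry_closed[OF i] by (intro finsum_cong') (auto simp: l_distr relation_closed)
    also have "\<dots> = (\<Oplus>e\<in>E. w e \<otimes> A i e) \<oplus> (\<Oplus>e\<in>E. w' e \<otimes> A i e)"
      using assms entry_closed[OF i] by (intro finsum_addf) (auto simp: relation_closed)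
    finally show ?thesis using assms i by (simp add: relation_def)
  qed
  then show ?thesis using assms by (auto simp: relation_def)
qed

lemma relation_add_scaled:
  "relation w \<Longrightarrow> relation w' \<Longrightarrow> a \<in> carrier R \<Longrightarrow> relation (\<lambda>e. w e \<oplus> a \<otimes> w' e)"
  by (intro relation_add relation_scale)

lemma relation_zero: "relation (\<lambda>_. \<zero>)"
proof -
  have "(\<Oplus>e\<in>E. \<zero> \<otimes> A i e) = \<zero>" if "i < r" for i
    using entry_closed[OF that] by (intro add.finprod_one_eqI) auto
  then show ?thesis by (auto simp: relation_def)
qed

lemma relation_cong:
  assumes "relation w" "\<And>e. e \<in> E \<Longrightarrow> w' e = w e"
  shows "relation w'"
proof -
  have "(\<Oplus>e\<in>E. w' e \<otimes> A i e) = (\<Oplus>e\<in>E. w e \<otimes> A i e)" if "i < r" for i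
    using assms entry_closed[OF that] by (intro finsum_cong') (auto simp: relation_closed)
  then show ?thesis using assms by (auto simp: relation_def)
qed

lemma relation_finsum:
  "finite J \<Longrightarrow> (\<And>j. j \<in> J \<Longrightarrow> relation (w j)) \<Longrightarrow> relation (\<lambda>e. \<Oplus>j\<in>J. w j e)"
proof (induction J rule: finite_induct)
  case empty
  then show ?case by (simp add: relation_zero)
next
  case (insert k J)
  have "relation (\<lambda>e. w k e \<oplus> (\<Oplus>j\<in>J. w j e))" using insert by (intro relation_add) auto
  then show ?case
    by (rule relation_cong) (use insert in \<open>auto intro!: finsum_insert simp: relation_closed\<close>)
qed

lemma finsum_supported:
  assumes "X \<subseteq> E" "\<And>e. e \<in> E - X \<Longrightarrow> w e = \<zero>" "w \<in> E \<rightarrow> carrier R" "i < r"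
  shows "(\<Oplus>e\<in>E. w e \<otimes> A i e) = (\<Oplus>e\<in>X. w e \<otimes> A i e)"
  using assms finite_columns entry_closed[OF assms(4)]
  by (intro add.finprod_mono_neutral_cong_right) (auto simp: subset_eq Pi_iff)

lemma lin_indep_columnsD:
  assumes L: "lin_indep_columns R r A X" and "X \<subseteq> E" "relation w" "\<And>e. e \<in> E - X \<Longrightarrow> w e = \<zero>"
    and "e \<in> E"
  shows "w e = \<zero>"
proof (cases "e \<in> X")
  case True
  have "w \<in> X \<rightarrow> carrier R" using assms(2,3) by (auto simp: relation_closed)
  moreover have "(\<Oplus>e\<in>X. w e \<otimes> A i e) = \<zero>" if "i < r" for i
    using finsum_supported[of X w i] assms that by (auto simp: relation_def)
  ultimately show ?thesis using L True unfolding lin_indep_columns_def by blast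
next
  case False
  then show ?thesis using assms by blast
qed

lemma dependent_relation:
  assumes L: "\<not> lin_indep_columns R r A X" and X: "X \<subseteq> E"
  obtains w where "relation w" "\<And>e. e \<notin> X \<Longrightarrow> w e = \<zero>" "\<exists>e\<in>X. w e \<noteq> \<zero>"
proof -
  obtain c where c: "c \<in> X \<rightarrow> carrier R" "\<And>i. i < r \<Longrightarrow> (\<Oplus>e\<in>X. c e \<otimes> A i e) = \<zero>"
    "\<exists>e\<in>X. c e \<noteq> \<zero>"
    using L unfolding lin_indep_columns_def by blast
  define w where "w e = (if e \<in> X then c e else \<zero>)" for e
  have w: "w \<in> E \<rightarrow> carrier R" using c(1) by (auto simp: w_def)
  have "(\<Oplus>e\<in>E. w e \<otimes> A i e) = \<zero>" if i: "i < r" for i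
  proof -
    have "(\<Oplus>e\<in>E. w e \<otimes> A i e) = (\<Oplus>e\<in>X. w e \<otimes> A i e)"
      by (rule finsum_supported[OF X _ w i]) (simp add: w_def)
    also have "\<dots> = (\<Oplus>e\<in>X. c e \<otimes> A i e)"
      using c(1) entry_closed[OF i] X by (intro finsum_cong') (auto simp: w_def subset_eq Pi_iff)
    finally show ?thesis using c(2)[OF i] by simp
  qed
  then have "relation w" using w by (simp add: relation_def)
  then show ?thesis by (rule that) (use c(3) in \<open>simp_all add: w_def\<close>)
qed

text \<open>A dependence on \<open>insert x X\<close> must involve \<open>x\<close>, as otherwise it
  would be one on the independent \<open>X\<close>; dividing by that coefficient normalises
  it.\<close>

lemma fundamental_relation:
  assumes "\<not> lin_indep_columns R r A (insert x X)" and L: "lin_indep_columns R r A X"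
    and X: "insert x X \<subseteq> E"
  obtains w where "relation w" "w x = \<one>" "\<And>e. e \<notin> insert x X \<Longrightarrow> w e = \<zero>"
proof -
  obtain w where w: "relation w" "\<And>e. e \<notin> insert x X \<Longrightarrow> w e = \<zero>" "\<exists>e\<in>insert x X. w e \<noteq> \<zero>"
    using dependent_relation[OF assms(1) X] by blast
  have "w x \<noteq> \<zero>"
  proof
    assume "w x = \<zero>"
    then have "w e = \<zero>" if "e \<notin> X" for e using w(2)[of e] that by (cases "e = x") auto
    then have "w e = \<zero>" if "e \<in> E" for e
      using lin_indep_columnsD[OF L _ w(1) _ that] X by simp
    then show False using w(3) X by blast
  qed
  moreover have "w x \<in> carrier R" using relation_closed[OF w(1)] X by blast
  ultimately have "w x \<in> Units R" by (simp add: field_Units)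
  then have "relation (\<lambda>e. inv (w x) \<otimes> w e)" "inv (w x) \<otimes> w x = \<one>"
    using w(1) by (simp_all add: relation_scale)
  then show ?thesis by (rule that) (use w(2) \<open>w x \<in> Units R\<close> in simp)
qed

end

lemma lin_indep_columns_image:
  assumes R: "field R" and f: "inj f" and X: "finite X"
    and A: "\<And>i x. i < r \<Longrightarrow> x \<in> X \<Longrightarrow> A i (f x) \<in> carrier R"
  shows "lin_indep_columns R r A (f ` X) \<longleftrightarrow> lin_indep_columns R r (\<lambda>i x. A i (f x)) X"
proof -
  interpret field R by (rule R)
  have sum: "(\<Oplus>\<^bsub>R\<^esub>e\<in>f ` X. c e \<otimes>\<^bsub>R\<^esub> A i e) = (\<Oplus>\<^bsub>R\<^esub>x\<in>X. c (f x) \<otimes>\<^bsub>R\<^esub> A i (f x))"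
    if "c \<in> f ` X \<rightarrow> carrier R" "i < r" for c i
    using that A f by (intro finsum_reindex) (auto intro: inj_on_subset simp: Pi_iff)
  show ?thesis
  proof
    assume L: "lin_indep_columns R r A (f ` X)"
    show "lin_indep_columns R r (\<lambda>i x. A i (f x)) X"
      unfolding lin_indep_columns_def
    proof (intro ballI impI)
      fix c x assume c: "c \<in> X \<rightarrow> carrier R" and x: "x \<in> X"
        and z: "\<forall>i<r. (\<Oplus>\<^bsub>R\<^esub>x\<in>X. c x \<otimes>\<^bsub>R\<^esub> A i (f x)) = \<zero>\<^bsub>R\<^esub>"
      define d where "d e = c (inv_into UNIV f e)" for e
      have d: "d \<in> f ` X \<rightarrow> carrier R" using c f by (auto simp: d_def)
      have "(\<Oplus>\<^bsub>R\<^esub>e\<in>f ` X. d e \<otimes>\<^bsub>R\<^esub> A i e) = \<zero>\<^bsub>R\<^esub>" if "i < r" for i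
        using sum[OF d that] z that f by (simp add: d_def)
      then have "d (f x) = \<zero>\<^bsub>R\<^esub>" using L d x unfolding lin_indep_columns_def by blast
      then show "c x = \<zero>\<^bsub>R\<^esub>" using f by (simp add: d_def)
    qed
  next
    assume L: "lin_indep_columns R r (\<lambda>i x. A i (f x)) X"
    show "lin_indep_columns R r A (f ` X)"
      unfolding lin_indep_columns_def
    proof (intro ballI impI)
      fix d e assume d: "d \<in> f ` X \<rightarrow> carrier R" and e: "e \<in> f ` X"
        and z: "\<forall>i<r. (\<Oplus>\<^bsub>R\<^esub>e\<in>f ` X. d e \<otimes>\<^bsub>R\<^esub> A i e) = \<zero>\<^bsub>R\<^esub>"
      have "(\<lambda>x. d (f x)) \<in> X \<rightarrow> carrier R" using d by auto
      moreover have "\<forall>i<r. (\<Oplus>\<^bsub>R\<^esub>x\<in>X. d (f x) \<otimes>\<^bsub>R\<^esub> A i (f x)) = \<zero>\<^bsub>R\<^esub>"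
        using z sum[OF d] by simp
      ultimately have "\<forall>x\<in>X. d (f x) = \<zero>\<^bsub>R\<^esub>"
        using L unfolding lin_indep_columns_def by (auto dest!: bspec[where x = "\<lambda>x. d (f x)"])
      then show "d e = \<zero>\<^bsub>R\<^esub>" using e by blast
    qed
  qed
qed

section \<open>Lazarson's matroids\<close>

text \<open>With rows \<open>i \<le> n\<close>, the columns are the unit vectors \<open>Inl j\<close> and the vectors \<open>Inr j\<close> that are
  \<open>1\<close> except in row \<open>j\<close>; as there is no row \<open>Suc n\<close>, the column \<open>Inr (Suc n)\<close> is the all-ones
  vector.\<close>

definition lazarson_ground :: "nat \<Rightarrow> (nat + nat) set" where
  "lazarson_ground n = Inl ` {..n} \<union> Inr ` {..Suc n}"

definition lazarson_matrix :: "nat \<Rightarrow> nat + nat \<Rightarrow> int" where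
  "lazarson_matrix i x = (case x of Inl j \<Rightarrow> of_bool (i = j) | Inr j \<Rightarrow> of_bool (i \<noteq> j))"

lemma lazarson_matrix_simps [simp]:
  "lazarson_matrix i (Inl j) = of_bool (i = j)" "lazarson_matrix i (Inr j) = of_bool (i \<noteq> j)"
  by (simp_all add: lazarson_matrix_def)

lemma (in abelian_group) add_minus_eq_zero_iff:
  "x \<in> carrier G \<Longrightarrow> y \<in> carrier G \<Longrightarrow> x \<oplus> \<ominus> y = \<zero> \<longleftrightarrow> x = y"
  using minus_equality[of "x" "\<ominus> y"] by (auto simp: r_neg)

text \<open>Write \<open>u\<^sub>i\<close>, \<open>b\<^sub>i\<close> and \<open>c\<close> for the vectors \<open>Inl i\<close>, \<open>Inr i\<close> and \<open>Inr (Suc n)\<close> of a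
  representation. The relation \<open>g\<close> expresses \<open>c\<close> through the \<open>u\<^sub>i\<close>, and the \<open>i\<close>-th relation
  \<open>h\<close> expresses a multiple of \<open>b\<^sub>i\<close> through \<open>c\<close> and \<open>u\<^sub>i\<close>, with the same coefficient of \<open>u\<^sub>i\<close> as in
  \<open>g\<close>. Eliminating the \<open>b\<^sub>i\<close> and \<open>c\<close> from a relation among the \<open>b\<^sub>i\<close> forces each of its \<open>n + 1\<close>
  rescaled coefficients to equal their sum \<open>S \<noteq> 0\<close>, whence \<open>(n + 1) S = S\<close>.\<close>

lemma lazarson_char:
  fixes B :: "nat \<Rightarrow> nat + nat \<Rightarrow> 'k"
  assumes "column_matrix R r (lazarson_ground n) B"
  defines "L \<equiv> lin_indep_columns R r B" and "c \<equiv> Inr (Suc n)"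
  assumes units: "L (Inl ` {..n})" "\<And>i. i \<le> n \<Longrightarrow> L (Inl ` ({..n} - {i}))"
    and ones: "\<not> L (insert c (Inl ` {..n}))"
    and pairs: "\<And>i. i \<le> n \<Longrightarrow> L {c, Inl i}" "\<And>i. i \<le> n \<Longrightarrow> L {c, Inr i}"
      "\<And>i. i \<le> n \<Longrightarrow> L {Inl i, Inr i}"
    and triple: "\<And>i. i \<le> n \<Longrightarrow> \<not> L {c, Inl i, Inr i}"
    and hyperplane: "\<And>i. i \<le> n \<Longrightarrow> \<not> L (insert (Inr i) (Inl ` ({..n} - {i})))"
    and complements: "\<not> L (Inr ` {..n})"
  shows "[n] \<cdot>\<^bsub>R\<^esub> \<one>\<^bsub>R\<^esub> = \<zero>\<^bsub>R\<^esub>"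
proof -
  interpret column_matrix R r "lazarson_ground n" B by fact
  note ground = lazarson_ground_def c_def
  obtain g where g: "relation g" "g c = \<one>\<^bsub>R\<^esub>" "\<And>e. e \<notin> insert c (Inl ` {..n}) \<Longrightarrow> g e = \<zero>\<^bsub>R\<^esub>"
    using fundamental_relation[of c "Inl ` {..n}"] ones units(1) by (auto simp: L_def ground)
  have "\<exists>w. relation w \<and> w c = \<one>\<^bsub>R\<^esub> \<and> (\<forall>e. e \<notin> {c, Inl i, Inr i} \<longrightarrow> w e = \<zero>\<^bsub>R\<^esub>)" if "i \<le> n" for i
  proof -
    have "{c, Inl i, Inr i} \<subseteq> lazarson_ground n" using that by (auto simp: ground)
    from fundamental_relation[OF triple[OF that, unfolded L_def] pairs(3)[OF that, unfolded L_def] this]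
    show ?thesis by blast
  qed
  then obtain h where h: "\<And>i. i \<le> n \<Longrightarrow> relation (h i)" "\<And>i. i \<le> n \<Longrightarrow> h i c = \<one>\<^bsub>R\<^esub>"
    "\<And>i e. i \<le> n \<Longrightarrow> e \<notin> {c, Inl i, Inr i} \<Longrightarrow> h i e = \<zero>\<^bsub>R\<^esub>" by metis
  have gc: "g e \<in> carrier R" for e
    using relation_closed[OF g(1)] g(3)[of e] by (cases "e \<in> insert c (Inl ` {..n})") (auto simp: ground)
  have hc: "h i e \<in> carrier R" if "i \<le> n" for i e
    using relation_closed[OF h(1)[OF that]] h(3)[OF that, of e] that
    by (cases "e \<in> {c, Inl i, Inr i}") (auto simp: ground)
  have g_compl: "g (Inr j) = \<zero>\<^bsub>R\<^esub>" if "j \<noteq> Suc n" for j by (rule g(3)) (use that in \<open>auto simp: c_def\<close>)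
  have h_compl_zero: "h i (Inr j) = \<zero>\<^bsub>R\<^esub>" if "i \<le> n" "j \<noteq> Suc n" "j \<noteq> i" for i j
    by (rule h(3)) (use that in \<open>auto simp: c_def\<close>)
  have h_unit_zero: "h i (Inl j) = \<zero>\<^bsub>R\<^esub>" if "i \<le> n" "j \<noteq> i" for i j
    by (rule h(3)) (use that in \<open>auto simp: c_def\<close>)
  have h_compl: "h i (Inr i) \<noteq> \<zero>\<^bsub>R\<^esub>" if i: "i \<le> n" for i
  proof
    assume "h i (Inr i) = \<zero>\<^bsub>R\<^esub>"
    then have "h i e = \<zero>\<^bsub>R\<^esub>" if "e \<notin> {c, Inl i}" for e using h(3)[OF i, of e] that by auto
    then have "h i c = \<zero>\<^bsub>R\<^esub>"
      using lin_indep_columnsD[of "{c, Inl i}" "h i" c] pairs(1)[OF i] h(1)[OF i] i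
      by (auto simp: L_def ground)
    then show False using h(2)[OF i] by simp
  qed
  have h_unit: "h i (Inl i) \<noteq> \<zero>\<^bsub>R\<^esub>" if i: "i \<le> n" for i
  proof
    assume "h i (Inl i) = \<zero>\<^bsub>R\<^esub>"
    then have "h i e = \<zero>\<^bsub>R\<^esub>" if "e \<notin> {c, Inr i}" for e using h(3)[OF i, of e] that by auto
    then have "h i c = \<zero>\<^bsub>R\<^esub>"
      using lin_indep_columnsD[of "{c, Inr i}" "h i" c] pairs(2)[OF i] h(1)[OF i] i
      by (auto simp: L_def ground)
    then show False using h(2)[OF i] by simp
  qed
  have units_zero: "w (Inl j) = \<zero>\<^bsub>R\<^esub>" if "relation w" "\<And>j. j \<le> Suc n \<Longrightarrow> w (Inr j) = \<zero>\<^bsub>R\<^esub>" "j \<le> n" for w j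
    using lin_indep_columnsD[of "Inl ` {..n}" w "Inl j"] units(1) that
    by (auto simp: L_def ground)
  have gh: "g (Inl i) = h i (Inl i)" if i: "i \<le> n" for i
  proof -
    obtain k where k: "relation k" "k (Inr i) = \<one>\<^bsub>R\<^esub>"
      "\<And>e. e \<notin> insert (Inr i) (Inl ` ({..n} - {i})) \<Longrightarrow> k e = \<zero>\<^bsub>R\<^esub>"
      using fundamental_relation[of "Inr i" "Inl ` ({..n} - {i})"] hyperplane[OF i] units(2)[OF i] i
      by (auto simp: L_def ground)
    have k_compl: "k (Inr j) = \<zero>\<^bsub>R\<^esub>" if "j \<noteq> i" for j by (rule k(3)) (use that in auto)
    \<comment> \<open>Here \<open>k\<close> expresses \<open>b\<^sub>i\<close> through the unit
      columns other than \<open>u\<^sub>i\<close>. The difference of \<open>g\<close> and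
      \<open>h i\<close> loses \<open>c\<close>, and adding the multiple of \<open>k\<close> removes
      \<open>b\<^sub>i\<close>. Only independent unit columns remain, so \<open>z\<close> vanishes;
      at \<open>u\<^sub>i\<close>, where \<open>k\<close> is zero, this equates \<open>g\<close> and
      \<open>h i\<close>.\<close>
    define z where "z e = (g e \<oplus>\<^bsub>R\<^esub> (\<ominus>\<^bsub>R\<^esub> \<one>\<^bsub>R\<^esub>) \<otimes>\<^bsub>R\<^esub> h i e) \<oplus>\<^bsub>R\<^esub> h i (Inr i) \<otimes>\<^bsub>R\<^esub> k e" for e
    have "relation z"
      unfolding z_def using g(1) h(1)[OF i] k(1) hc[OF i] by (intro relation_add_scaled) auto
    moreover have "z (Inr j) = \<zero>\<^bsub>R\<^esub>" if "j \<le> Suc n" for j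
    proof -
      consider "j = Suc n" | "j = i" "j \<noteq> Suc n" | "j \<noteq> i" "j \<noteq> Suc n" by blast
      then show ?thesis
      proof cases
        case 1
        then show ?thesis
          using g(2) h(2)[OF i] k_compl[of "Suc n"] i hc[OF i, of "Inr i"]
          by (simp add: z_def c_def r_neg)
      next
        case 2
        then show ?thesis
          using g_compl[of i] k(2) hc[OF i, of "Inr i"] by (simp add: z_def l_minus l_neg)
      next
        case 3
        then show ?thesis
          using g_compl[of j] h_compl_zero[OF i, of j] k_compl[of j] hc[OF i, of "Inr i"]
          by (simp add: z_def)
      qed
    qed
    ultimately have "z (Inl i) = \<zero>\<^bsub>R\<^esub>" using i by (rule units_zero)
    moreover have "k (Inl i) = \<zero>\<^bsub>R\<^esub>" using k(3)[of "Inl i"] by auto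
    ultimately have "g (Inl i) \<oplus>\<^bsub>R\<^esub> \<ominus>\<^bsub>R\<^esub> h i (Inl i) = \<zero>\<^bsub>R\<^esub>"
      using gc[of "Inl i"] hc[OF i] by (simp add: z_def l_minus)
    then show ?thesis using gc hc[OF i] by (simp add: add_minus_eq_zero_iff)
  qed
  obtain v where v: "relation v" "\<And>e. e \<notin> Inr ` {..n} \<Longrightarrow> v e = \<zero>\<^bsub>R\<^esub>" "\<exists>e\<in>Inr ` {..n}. v e \<noteq> \<zero>\<^bsub>R\<^esub>"
  proof -
    have "Inr ` {..n} \<subseteq> lazarson_ground n" by (auto simp: ground)
    then show ?thesis using dependent_relation[of "Inr ` {..n}"] complements that unfolding L_def by blast
  qed
  have v_zero: "v (Inl j) = \<zero>\<^bsub>R\<^esub>" "v (Inr (Suc n)) = \<zero>\<^bsub>R\<^esub>" for j by (rule v(2); auto)+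
  have vc: "v (Inr j) \<in> carrier R" if "j \<le> n" for j
    using relation_closed[OF v(1), of "Inr j"] that by (auto simp: ground)
  \<comment> \<open>Scaled so that the sum \<open>y\<close> of the \<open>l i\<close> multiples of
    the \<open>h i\<close> has the same coefficients at the \<open>b\<^sub>i\<close> as
    \<open>v\<close>. Its coefficient at \<open>c\<close> is then \<open>S\<close>.\<close>
  define l where "l i = v (Inr i) \<otimes>\<^bsub>R\<^esub> inv\<^bsub>R\<^esub> (h i (Inr i))" for i
  have hU: "h i (Inr i) \<in> Units R" if "i \<le> n" for i
    using h_compl[OF that] hc[OF that] by (simp add: field_Units)
  have lc: "l i \<in> carrier R" if "i \<le> n" for i
    using vc[OF that] hU[OF that] by (simp add: l_def)
  have lh: "l i \<otimes>\<^bsub>R\<^esub> h i (Inr i) = v (Inr i)" if "i \<le> n" for i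
    using vc[OF that] hU[OF that] hc[OF that] by (simp add: l_def m_assoc)
  define S where "S = (\<Oplus>\<^bsub>R\<^esub>i\<in>{..n}. l i)"
  have Sc: "S \<in> carrier R" using lc by (auto simp: S_def intro: finsum_closed)
  define y where "y e = (\<Oplus>\<^bsub>R\<^esub>i\<in>{..n}. l i \<otimes>\<^bsub>R\<^esub> h i e)" for e
  have y: "relation y"
    unfolding y_def using h(1) lc by (intro relation_finsum relation_scale) auto
  have y_c: "y c = S"
    unfolding y_def S_def using h(2) lc by (intro finsum_cong') auto
  have y_single: "y e = l j \<otimes>\<^bsub>R\<^esub> h j e" if "j \<le> n" "e = Inl j \<or> e = Inr j" for j e
  proof -
    have "y e = (\<Oplus>\<^bsub>R\<^esub>i\<in>{..n}. if j = i then l i \<otimes>\<^bsub>R\<^esub> h i e else \<zero>\<^bsub>R\<^esub>)"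
        unfolding y_def using that lc hc h_compl_zero[of _ j] h_unit_zero[of _ j]
      by (intro finsum_cong') auto
    also have "\<dots> = l j \<otimes>\<^bsub>R\<^esub> h j e"
      using that lc hc by (intro finsum_singleton) auto
    finally show ?thesis .
  qed
  \<comment> \<open>Subtracting \<open>y\<close> from \<open>v\<close> cancels every
    \<open>b\<^sub>i\<close> and leaves \<open>-S\<close> at \<open>c\<close>, which
    \<open>S\<close> times \<open>g\<close> restores to zero. The remaining unit coefficients must
    vanish, which by \<open>gh\<close> compares \<open>l j\<close> with \<open>S\<close>.\<close>
  define z where "z e = (v e \<oplus>\<^bsub>R\<^esub> (\<ominus>\<^bsub>R\<^esub> \<one>\<^bsub>R\<^esub>) \<otimes>\<^bsub>R\<^esub> y e) \<oplus>\<^bsub>R\<^esub> S \<otimes>\<^bsub>R\<^esub> g e" for e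
  have "relation z"
    unfolding z_def using v(1) y g(1) Sc by (intro relation_add_scaled) auto
  moreover have "z (Inr j) = \<zero>\<^bsub>R\<^esub>" if j: "j \<le> Suc n" for j
  proof (cases "j = Suc n")
    case True
    then show ?thesis
      using v_zero y_c g(2) Sc by (simp add: z_def c_def l_minus l_neg)
  next
    case False
    then have "j \<le> n" using j by simp
    then show ?thesis
      using y_single[of j "Inr j"] lh[of j] g_compl[of j] vc[of j] Sc
      by (simp add: z_def l_minus r_neg)
  qed
  ultimately have z: "z (Inl j) = \<zero>\<^bsub>R\<^esub>" if "j \<le> n" for j using that by (rule units_zero)
  have lS: "l j = S" if j: "j \<le> n" for j
  proof -
    have "\<ominus>\<^bsub>R\<^esub> (l j \<otimes>\<^bsub>R\<^esub> h j (Inl j)) \<oplus>\<^bsub>R\<^esub> S \<otimes>\<^bsub>R\<^esub> h j (Inl j) = \<zero>\<^bsub>R\<^esub>"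
      using z[OF j] v_zero y_single[OF j, of "Inl j"] gh[OF j] lc[OF j] hc[OF j] Sc
      by (simp add: z_def l_minus)
    then have "l j \<otimes>\<^bsub>R\<^esub> h j (Inl j) = S \<otimes>\<^bsub>R\<^esub> h j (Inl j)"
      using lc[OF j] hc[OF j] Sc by (simp add: a_comm[of "\<ominus>\<^bsub>R\<^esub> _"] add_minus_eq_zero_iff)
    then show ?thesis using lc[OF j] hc[OF j] Sc h_unit[OF j] by (simp add: m_rcancel)
  qed
  have "S \<noteq> \<zero>\<^bsub>R\<^esub>"
  proof
    assume "S = \<zero>\<^bsub>R\<^esub>"
    then have "v (Inr j) = \<zero>\<^bsub>R\<^esub>" if "j \<le> n" for j
      using lh[OF that] lS[OF that] hc[OF that] by simp
    then show False using v(3) by auto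
  qed
  have "S = (\<Oplus>\<^bsub>R\<^esub>i\<in>{..n}. S)"
    using lS Sc unfolding S_def[symmetric] by (subst S_def) (intro finsum_cong', auto)
  also have "\<dots> = [Suc n] \<cdot>\<^bsub>R\<^esub> S" using add.finprod_const[of S "{..n}"] Sc by simp
  also have "\<dots> = [n] \<cdot>\<^bsub>R\<^esub> S \<oplus>\<^bsub>R\<^esub> S" by simp
  finally have "[n] \<cdot>\<^bsub>R\<^esub> S \<oplus>\<^bsub>R\<^esub> S = \<zero>\<^bsub>R\<^esub> \<oplus>\<^bsub>R\<^esub> S" using Sc by simp
  then have "[n] \<cdot>\<^bsub>R\<^esub> S = \<zero>\<^bsub>R\<^esub>" using Sc by (subst (asm) add.right_cancel) auto
  then have "[n] \<cdot>\<^bsub>R\<^esub> \<one>\<^bsub>R\<^esub> \<otimes>\<^bsub>R\<^esub> S = \<zero>\<^bsub>R\<^esub>" using add_pow_ldistr[of "\<one>\<^bsub>R\<^esub>" S n] Sc by simp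
  then show ?thesis using \<open>S \<noteq> \<zero>\<^bsub>R\<^esub>\<close> Sc integral by blast
qed

section \<open>Dependences and independences of Lazarson's columns modulo \<open>p\<close>\<close>

lemma indep_mod_Inl:
  assumes "J \<subseteq> {..<r}"
  shows "indep_mod p r lazarson_matrix (Inl ` J :: (nat + nat) set)"
  unfolding indep_mod_def
proof (intro allI impI ballI)
  fix c :: "nat + nat \<Rightarrow> int" and e :: "nat + nat"
  assume c: "\<forall>i<r. p dvd (\<Sum>e\<in>Inl ` J. c e * lazarson_matrix i e)" and "e \<in> Inl ` J"
  then obtain j where j: "j \<in> J" "e = Inl j" by blast
  have "finite J" using assms finite_subset by blast
  have "(\<Sum>e\<in>Inl ` J. c e * lazarson_matrix j e) = c e"
    using j \<open>finite J\<close> by (simp add: sum.reindex of_bool_def if_distrib cong: if_cong)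
  then show "p dvd c e" using c j assms by fastforce
qed

lemma not_indep_modI:
  assumes "\<And>i. i < r \<Longrightarrow> p dvd (\<Sum>e\<in>X. c e * A i e)" "e \<in> X" "\<not> p dvd c e"
  shows "\<not> indep_mod p r A X"
  using assms indep_modD[of p r A X c e] by blast

text \<open>Cramer's rule: the minor of rows \<open>i\<close> and \<open>j\<close> is 1 or -1, so it
  can be cancelled modulo any \<open>p\<close>.\<close>

lemma indep_mod_pair:
  assumes "x \<noteq> y" "i < r" "j < r" and unimod: "A i x * A j y - A j x * A i y \<in> {1, - 1}"
  shows "indep_mod p r A {x, y}"
  unfolding indep_mod_def
proof (intro allI impI)
  fix c assume "\<forall>i<r. p dvd (\<Sum>e\<in>{x, y}. c e * A i e)"
  then have *: "p dvd c x * A i x + c y * A i y" "p dvd c x * A j x + c y * A j y"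
    using assms(1-3) by auto
  let ?D = "A i x * A j y - A j x * A i y"
  have "c x * ?D = (c x * A i x + c y * A i y) * A j y - (c x * A j x + c y * A j y) * A i y"
    "c y * ?D = (c x * A j x + c y * A j y) * A i x - (c x * A i x + c y * A i y) * A j x"
    by (simp_all add: algebra_simps)
  then have "p dvd c x * ?D" "p dvd c y * ?D" using * by (metis dvd_diff dvd_mult2)+
  then show "\<forall>e\<in>{x, y}. p dvd c e" using unimod by auto
qed

text \<open>Supplies the hypotheses of \<open>lazarson_char\<close> for \<open>n = p\<close>. The
  dependences come from the integer identities \<open>c = \<Sum> u\<^sub>j\<close>,
  \<open>c = u\<^sub>i + b\<^sub>i\<close> and \<open>b\<^sub>i = \<Sum> u\<^sub>j\<close> over
  \<open>j \<noteq> i\<close>; only the last claim uses reduction modulo \<open>p\<close>.\<close>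

lemma lazarson_indep_mod:
  fixes p :: nat
  assumes p: "1 < p"
  defines "L \<equiv> indep_mod (int p) (Suc p) lazarson_matrix"
  shows "\<not> L (insert (Inr (Suc p)) (Inl ` {..p}))"
    and "i \<le> p \<Longrightarrow> L {Inr (Suc p), Inl i}" and "i \<le> p \<Longrightarrow> L {Inr (Suc p), Inr i}"
    and "i \<le> p \<Longrightarrow> L {Inl i, Inr i}"
    and "i \<le> p \<Longrightarrow> \<not> L {Inr (Suc p), Inl i, Inr i}"
    and "i \<le> p \<Longrightarrow> \<not> L (insert (Inr i) (Inl ` ({..p} - {i})))"
    and "\<not> L (Inr ` {..p})"
proof -
  show "\<not> L (insert (Inr (Suc p)) (Inl ` {..p}))"
    unfolding L_def
  proof (rule not_indep_modI[where c = "case_sum (\<lambda>_. - 1) (\<lambda>_. 1)" and e = "Inr (Suc p)"])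
    fix k assume k: "k < Suc p"
    have "(\<Sum>e\<in>Inl ` {..p}. case_sum (\<lambda>_. - 1) (\<lambda>_. 1) e * lazarson_matrix k e)
        = - (\<Sum>j\<in>{..p}. of_bool (k = j))"
      by (simp add: sum.reindex sum_negf)
    also have "\<dots> = - 1" using k by (simp add: of_bool_def)
    finally show "int p dvd (\<Sum>e\<in>insert (Inr (Suc p)) (Inl ` {..p}).
        case_sum (\<lambda>_. - 1) (\<lambda>_. 1) e * lazarson_matrix k e)"
      using k by (subst sum.insert) auto
  qed (use p in auto)
  show "\<not> L (Inr ` {..p})"
    unfolding L_def
  \<comment> \<open>Row \<open>i\<close> has its only zero at \<open>Inr i\<close> among these
    \<open>p + 1\<close> columns, so it sums to \<open>p\<close>.\<close>
  proof (rule not_indep_modI[where c = "\<lambda>_. 1" and e = "Inr 0"])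
    fix i assume i: "i < Suc p"
    have "(\<Sum>e\<in>Inr ` {..p}. 1 * lazarson_matrix i e) = (\<Sum>j\<le>p. of_bool (i \<noteq> j))"
      by (simp add: sum.reindex)
    also have "\<dots> = (\<Sum>j\<in>{..p} - {i}. 1)"
      by (rule sum.mono_neutral_cong_right) auto
    also have "\<dots> = int p" using i by simp
    finally show "int p dvd (\<Sum>e\<in>Inr ` {..p}. 1 * lazarson_matrix i e)" by simp
  qed (use p in auto)
next
  assume i: "i \<le> p"
  \<comment> \<open>A second row, available because \<open>p > 1\<close>; rows \<open>i\<close> and
    \<open>j\<close> give the required minor for all three pairs.\<close>
  obtain j where j: "j \<le> p" "j \<noteq> i" using p by (metis less_imp_le not_one_le_zero le0 order_refl)
  show "L {Inr (Suc p), Inl i}" "L {Inr (Suc p), Inr i}" "L {Inl i, Inr i}"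
    unfolding L_def by (rule indep_mod_pair[of _ _ i _ j]; use i j in simp)+
  show "\<not> L {Inr (Suc p), Inl i, Inr i}"
    unfolding L_def using p i
    by (intro not_indep_modI[where c = "\<lambda>e. if e = Inr (Suc p) then 1 else - 1" and e = "Inr (Suc p)"]) auto
  show "\<not> L (insert (Inr i) (Inl ` ({..p} - {i})))"
    unfolding L_def
  proof (rule not_indep_modI[where c = "case_sum (\<lambda>_. - 1) (\<lambda>_. 1)" and e = "Inr i"])
    fix k assume k: "k < Suc p"
    have "(\<Sum>e\<in>Inl ` ({..p} - {i}). case_sum (\<lambda>_. - 1) (\<lambda>_. 1) e * lazarson_matrix k e)
        = - (\<Sum>j\<in>{..p} - {i}. of_bool (k = j))"
      by (simp add: sum.reindex sum_negf)
    also have "\<dots> = - of_bool (k \<noteq> i)" using k by (simp add: of_bool_def)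
    finally show "int p dvd (\<Sum>e\<in>insert (Inr i) (Inl ` ({..p} - {i})).
        case_sum (\<lambda>_. - 1) (\<lambda>_. 1) e * lazarson_matrix k e)"
      by (subst sum.insert) auto
  qed (use p in auto)
qed

section \<open>Relabelled copies and the characteristic they force\<close>

text \<open>The labelling \<open>f\<close> is a parameter because disjoint copies for the two
  summands must live in one type; columns are looked up through the inverse of
  \<open>f\<close>.\<close>

definition lazarson :: "(nat + nat \<Rightarrow> 'e) \<Rightarrow> nat \<Rightarrow> 'e set \<Rightarrow> bool" where
  "lazarson f p X \<longleftrightarrow> X \<subseteq> f ` lazarson_ground p \<and>
     indep_mod (int p) (Suc p) (\<lambda>i e. lazarson_matrix i (inv_into UNIV f e)) X"

lemma finite_lazarson_ground: "finite (lazarson_ground p)"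
  by (simp add: lazarson_ground_def)

lemma matroid_lazarson: "prime p \<Longrightarrow> matroid (f ` lazarson_ground p) (lazarson f p)"
  unfolding lazarson_def[abs_def] by (rule matroid_indep_mod) (simp_all add: finite_lazarson_ground)

lemma representable_direct_sum_lazarson:
  assumes "prime p" "range f \<inter> range g = {}"
  shows "representable (f ` lazarson_ground p \<union> g ` lazarson_ground p)
    (direct_sum (f ` lazarson_ground p) (lazarson f p) (g ` lazarson_ground p) (lazarson g p))"
  unfolding lazarson_def[abs_def]
  by (rule representable_direct_sum_indep_mod) (use assms in \<open>auto simp: finite_lazarson_ground\<close>)

text \<open>The hypotheses of \<open>lazarson_char\<close> mention only which sets of columns are
  independent. They can therefore be checked modulo \<open>p\<close> and carried over to a
  representation over any field \<open>F\<close>.\<close>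

lemma lazarson_representable_char:
  assumes F: "field F" and rep: "representable_over F (f ` lazarson_ground p) (lazarson f p)"
    and f: "inj f" and p: "prime p"
  shows "[p] \<cdot>\<^bsub>F\<^esub> \<one>\<^bsub>F\<^esub> = \<zero>\<^bsub>F\<^esub>"
proof -
  obtain r A where A: "\<forall>i<r. \<forall>e\<in>f ` lazarson_ground p. A i e \<in> carrier F"
    and iff: "\<forall>X\<subseteq>f ` lazarson_ground p. lazarson f p X \<longleftrightarrow> lin_indep_columns F r A X"
    using rep unfolding representable_over_def by (elim exE conjE)
  define B where "B i x = A i (f x)" for i x
  define L where "L = indep_mod (int p) (Suc p) lazarson_matrix"
  have L: "lin_indep_columns F r B X \<longleftrightarrow> L X" if X: "X \<subseteq> lazarson_ground p" for X
  proof -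
    have "lin_indep_columns F r B X \<longleftrightarrow> lin_indep_columns F r A (f ` X)"
      unfolding B_def using X A finite_subset[OF X finite_lazarson_ground]
      by (intro lin_indep_columns_image[OF F f, symmetric]) auto
    also have "\<dots> \<longleftrightarrow> lazarson f p (f ` X)" by (rule iff[rule_format, symmetric]) (use X in blast)
    also have "\<dots> \<longleftrightarrow> L X" using X by (auto simp: lazarson_def L_def indep_mod_image[OF f])
    finally show ?thesis .
  qed
  have "1 < p" using p by (rule prime_gt_1_nat)
  note facts = lazarson_indep_mod[OF this, folded L_def]
  have matrix: "column_matrix F r (lazarson_ground p) B"
    using F A by (intro column_matrix.intro column_matrix_axioms.intro)
      (auto simp: B_def finite_lazarson_ground)
  have units: "L (Inl ` J)" if "J \<subseteq> {..p}" for J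
    unfolding L_def by (rule indep_mod_Inl) (use that in auto)
  have sub: "Inl ` J \<subseteq> lazarson_ground p" if "J \<subseteq> {..p}" for J
    using that by (auto simp: lazarson_ground_def)
  have mem: "i \<le> p \<Longrightarrow> Inl i \<in> lazarson_ground p" "i \<le> Suc p \<Longrightarrow> Inr i \<in> lazarson_ground p" for i
    by (auto simp: lazarson_ground_def)
  show ?thesis
  proof (rule lazarson_char[OF matrix])
    show "\<not> lin_indep_columns F r B (Inr ` {..p})"
      using facts(7) by (subst L) (auto simp: mem)
  qed (subst L; use facts units sub mem in \<open>simp\<close>)+
qed

text \<open>By Bezout, \<open>p * x = q * y + 1\<close>; multiples of \<open>p\<close> and
  \<open>q\<close> annihilate \<open>\<one>\<close>, which would give
  \<open>\<one> = \<zero>\<close>.\<close>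

lemma (in field) char_coprime:
  assumes "[p] \<cdot> \<one> = \<zero>" "[q] \<cdot> \<one> = \<zero>"
  shows "\<not> coprime (p :: nat) q"
proof
  assume cop: "coprime p q"
  have mult: "[(m * n)] \<cdot> \<one> = \<zero>" if "[m] \<cdot> \<one> = \<zero>" for m n :: nat
    using add.nat_pow_pow[OF one_closed, of n m] add.nat_pow_one that by simp
  show False
  proof (cases "p = 0")
    case True
    then show False using cop assms by simp
  next
    case False
    then obtain x y where "p * x = q * y + 1" using cop bezout_nat[of p q] by auto
    moreover have "[(q * y + 1)] \<cdot> \<one> = [(q * y)] \<cdot> \<one> \<oplus> \<one>" by simp
    ultimately show False using mult[OF assms(1), of x] mult[OF assms(2), of y] by simp
  qed
qed

section \<open>Undefinability of representability\<close>

theorem theorem1p1: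
  shows "\<not> (\<exists>\<psi>. sentence \<psi> \<and>
           (\<forall>(E :: nat set) (indep :: nat set \<Rightarrow> bool). matroid E indep \<longrightarrow>
              (representable E indep \<longleftrightarrow> satisfies E indep \<psi>)))"
proof
  assume "\<exists>\<psi>. sentence \<psi> \<and> (\<forall>(E :: nat set) (indep :: nat set \<Rightarrow> bool). matroid E indep \<longrightarrow>
    (representable E indep \<longleftrightarrow> satisfies E indep \<psi>))"
  then obtain \<psi> where \<psi>: "\<And>(E :: nat set) (indep :: nat set \<Rightarrow> bool). matroid E indep \<Longrightarrow>
      representable E indep \<longleftrightarrow> satisfies E indep \<psi>"
    by blast
  \<comment> \<open>Even and odd codes place the two summands disjointly in the naturals, whatever
    the primes.\<close>
  define f g :: "nat + nat \<Rightarrow> nat" where "f x = 2 * sum_encode x" and "g x = 2 * sum_encode x + 1" for x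
  have inj: "inj f" "inj g"
    by (auto simp: f_def g_def inj_def sum_encode_eq)
  have "f x \<noteq> g y" for x y unfolding f_def g_def by presburger
  then have disj: "range f \<inter> range g = {}" by auto
  define E D where "E p = f ` lazarson_ground p" and "D p = g ` lazarson_ground p" for p
  have ED: "E p \<inter> D q = {}" for p q using disj by (auto simp: E_def D_def)
  define M where "M p q = direct_sum (E p) (lazarson f p) (D q) (lazarson g q)" for p q
  have matroids: "matroid (E p) (lazarson f p)" "matroid (D p) (lazarson g p)" if "prime p" for p
    using matroid_lazarson[OF that] by (auto simp: E_def D_def)
  have M: "matroid (E p \<union> D q) (M p q)" if "prime p" "prime q" for p q
    unfolding M_def using that by (intro matroid_direct_sum matroids ED)
  obtain t :: "nat set \<times> (nat set \<Rightarrow> bool) \<times> (nat \<Rightarrow> nat set) \<Rightarrow> nat"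
    where t: "finite (range t)" "left_determines t \<psi>"
    using finite_left_types by blast
  define s where "s p = t (E p, lazarson f p, \<lambda>_. {})" for p
  \<comment> \<open>Pigeonhole: infinitely many primes, finitely many types.\<close>
  have "finite (s ` {p. prime p})" by (rule finite_subset[OF _ t(1)]) (auto simp: s_def)
  then have "\<not> inj_on s {p. prime p}" using primes_infinite finite_imageD by blast
  then obtain p q where pq: "prime p" "prime q" "p \<noteq> q" "s p = s q" by (auto simp: inj_on_def)
  have fin: "finite (E p)" "finite (D p)" for p
    by (simp_all add: E_def D_def finite_lazarson_ground)
  \<comment> \<open>The empty assignment of \<open>satisfies\<close>, written in the merged form
    that \<open>left_determinesD\<close> produces.\<close>
  have "holds (E p \<union> D q) (M p q) \<psi> (\<lambda>i. {} \<union> {}) \<longleftrightarrow> holds (E q \<union> D q) (M q q) \<psi> (\<lambda>i. {} \<union> {})"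
    unfolding M_def using pq(4)
    by (intro left_determinesD[OF t(2)]) (simp_all add: fin ED s_def)
  then have "satisfies (E p \<union> D q) (M p q) \<psi> \<longleftrightarrow> satisfies (E q \<union> D q) (M q q) \<psi>"
    by (simp add: satisfies_def)
  moreover have "representable (E q \<union> D q) (M q q)"
    unfolding M_def E_def D_def by (rule representable_direct_sum_lazarson[OF pq(2) disj])
  \<comment> \<open>The assumed equivalence is used twice: from representability of the sum with
    equal primes to truth of \<open>\<psi>\<close>, and from its truth in the mixed sum back to
    representability.\<close>
  ultimately have "representable (E p \<union> D q) (M p q)" using \<psi> M pq by blast
  then obtain F :: "nat ring" where F: "field F" "representable_over F (E p \<union> D q) (M p q)"
    unfolding representable_def by blast
  note reps = representable_over_direct_sumD[OF matroids(1)[OF pq(1)] matroids(2)[OF pq(2)] ED F(2)[unfolded M_def]]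
  have "[p] \<cdot>\<^bsub>F\<^esub> \<one>\<^bsub>F\<^esub> = \<zero>\<^bsub>F\<^esub>" "[q] \<cdot>\<^bsub>F\<^esub> \<one>\<^bsub>F\<^esub> = \<zero>\<^bsub>F\<^esub>"
    using lazarson_representable_char[OF F(1) reps(1)[unfolded E_def] inj(1) pq(1)]
      lazarson_representable_char[OF F(1) reps(2)[unfolded D_def] inj(2) pq(2)] by auto
  then have "\<not> coprime p q" using field.char_coprime[OF F(1)] by blast
  then show False using pq by (simp add: primes_coprime)
qed

end
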